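(* There exists an absolute constant $C\ge 1$ such that for every class $F$ of real-valued functions on a set $\Omega$, $$\frac1C\int_0^\infty \sqrt{v(F,t)}\,dt\ \le\ \int_0^\infty\sqrt{D(F,t)}\,dt\ \le\ C\int_0^\infty\sqrt{v(F,t)}\,dt .$$
   Context: **Combinatorial dimension.** For a class $F$ of real-valued functions on a set $\Omega$ and $t\ge 0$, a subset $\sigma\subseteq\Omega$ is $t$-shattered by $F$ if there is a function $h:\sigma\to\mathbb{R}$ such that for every partition $\sigma=\sigma_-\cup\sigma_+$ there is $f\in F$ with $f(x)\le h(x)$ for $x\in\sigma_-$ and $f(x)\ge h(x)+t$ for $x\in\sigma_+$. The combinatorial dimension $v(F,t)\in\{0,1,2,\dots\}\cup\{\infty\}$ is the maximal cardinality of a subset of $\Omega$ that is $t$-shattered by $F$. **Koltchinskii–Pollard entropy.** For $t>0$, $$D(F,t)=\log\sup\Big\{n : \exists f_1,\dots,f_n\in F\ \ \forall i<j\ \ \int (f_i-f_j)^2\,d\mu\ge t^2\Big\},$$ where the supremum is over $n$ and over all probability measures $\mu$ supported by finite subsets of $\Omega$. The value $\infty$ is allowed for all quantities. *)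

theory Defs
  imports "HOL-Probability.Probability"
begin

text \<open>
  A class of real-valued functions on a set \<open>\<Omega> :: 'a set\<close> is given as a set \<open>F\<close> of total functions
  on \<open>'a\<close>; all notions below depend only on the values taken on \<open>\<Omega>\<close>.
\<close>

definition shattered :: "('a \<Rightarrow> real) set \<Rightarrow> real \<Rightarrow> 'a set \<Rightarrow> bool" where
  "shattered F t \<sigma> \<longleftrightarrow>
     (\<exists>h :: 'a \<Rightarrow> real. \<forall>\<sigma>m \<sigma>p. \<sigma>m \<union> \<sigma>p = \<sigma> \<and> \<sigma>m \<inter> \<sigma>p = {} \<longrightarrow>
        (\<exists>f\<in>F. (\<forall>x\<in>\<sigma>m. f x \<le> h x) \<and> (\<forall>x\<in>\<sigma>p. f x \<ge> h x + t)))"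

definition ext_card :: "'a set \<Rightarrow> enat" where
  "ext_card A = (if finite A then enat (card A) else \<infinity>)"

definition comb_dim :: "'a set \<Rightarrow> ('a \<Rightarrow> real) set \<Rightarrow> real \<Rightarrow> enat" where
  "comb_dim \<Omega> F t = Sup {ext_card \<sigma> | \<sigma>. \<sigma> \<subseteq> \<Omega> \<and> shattered F t \<sigma>}"

text \<open>
  Probability measures supported by finite subsets of \<open>\<Omega>\<close> are probability mass functions with
  finite support contained in \<open>\<Omega>\<close>.
\<close>

definition packing_number :: "'a set \<Rightarrow> ('a \<Rightarrow> real) set \<Rightarrow> real \<Rightarrow> enat" where
  "packing_number \<Omega> F t =
     Sup {enat n | n. \<exists>(\<mu> :: 'a pmf) (f :: nat \<Rightarrow> 'a \<Rightarrow> real).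
            finite (set_pmf \<mu>) \<and> set_pmf \<mu> \<subseteq> \<Omega> \<and> (\<forall>i<n. f i \<in> F) \<and>
            (\<forall>i j. i < j \<and> j < n \<longrightarrow>
               measure_pmf.expectation \<mu> (\<lambda>x. (f i x - f j x)\<^sup>2) \<ge> t\<^sup>2)}"

text \<open>
  The value at \<open>0\<close> is \<open>ln 0 = 0\<close>. It is only used when \<open>F\<close> or \<open>\<Omega>\<close> is empty; such classes have
  entropy and combinatorial dimension zero.
\<close>

definition log_enat :: "enat \<Rightarrow> ennreal" where
  "log_enat n = (case n of enat k \<Rightarrow> ennreal (ln (real k)) | \<infinity> \<Rightarrow> \<infinity>)"

definition KP_entropy :: "'a set \<Rightarrow> ('a \<Rightarrow> real) set \<Rightarrow> real \<Rightarrow> ennreal" where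
  "KP_entropy \<Omega> F t = log_enat (packing_number \<Omega> F t)"

definition sqrt_ennreal :: "ennreal \<Rightarrow> ennreal" where
  "sqrt_ennreal x = (if x = \<infinity> then \<infinity> else ennreal (sqrt (enn2real x)))"

definition dim_integral :: "'a set \<Rightarrow> ('a \<Rightarrow> real) set \<Rightarrow> ennreal" where
  "dim_integral \<Omega> F =
     (\<integral>\<^sup>+t\<in>{0<..}. sqrt_ennreal (ennreal_of_enat (comb_dim \<Omega> F t)) \<partial>lborel)"

definition entropy_integral :: "'a set \<Rightarrow> ('a \<Rightarrow> real) set \<Rightarrow> ennreal" where
  "entropy_integral \<Omega> F = (\<integral>\<^sup>+t\<in>{0<..}. sqrt_ennreal (KP_entropy \<Omega> F t) \<partial>lborel)"

definition two_sided_bound :: "real \<Rightarrow> 'a set \<Rightarrow> ('a \<Rightarrow> real) set \<Rightarrow> bool" where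
  "two_sided_bound C \<Omega> F \<longleftrightarrow>
     ennreal (1 / C) * dim_integral \<Omega> F \<le> entropy_integral \<Omega> F \<and>
     entropy_integral \<Omega> F \<le> ennreal C * dim_integral \<Omega> F"

text \<open>
  An absolute constant must not depend on the type \<open>'a\<close> that contains \<open>\<Omega>\<close>, but in a theorem of the
  form \<open>\<exists>C. \<forall>(\<Omega> :: 'a set) F. \<dots>\<close> the type variable is quantified outside of \<open>C\<close>. The constant is
  therefore named by a closed term, so that a theorem about it at an arbitrary type is uniform in
  that type: it is some constant valid for all classes on sets of natural numbers. If an absolute
  constant exists, this one is absolute as well, since both integrals of a class \<open>F\<close> on \<open>\<Omega>\<close> equal
  those of a countable subclass of \<open>F\<close> on a countable subset of \<open>\<Omega>\<close> (collect finite witnesses for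
  the dimension and the packing number at each rational \<open>t > 0\<close>, and use monotonicity in \<open>t\<close>).
\<close>

definition absolute_const :: real where
  "absolute_const = (SOME C. C \<ge> 1 \<and> (\<forall>(\<Omega> :: nat set) F. two_sided_bound C \<Omega> F))"

end

theory Submission
  imports Defs
begin

text \<open>
  Upper bound. Let \<open>A\<close> be a finite \<open>t\<close>-separated subset of \<open>F\<close> in \<open>L\<^sub>2(\<mu>)\<close>. Passing to maximal \<open>2\<^sup>i t\<close>-separated
  subsets reduces the estimate to subsets of \<open>L\<^sub>2\<close> balls of radius comparable to the separation.
  There, two functions differ by a constant multiple of \<open>2\<^sup>k t\<close> on a set of measure at least \<open>c 8\<^sup>-\<^sup>k\<close>, for
  some \<open>k\<close>, even after clipping at height \<open>2\<^sup>k t\<close>. A clipped and rounded class takes a bounded number of values. If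
  its elements differ with probability at least \<open>\<beta>\<close>, then some coordinate splits off two large subclasses
  with well separated constant values, and iterating this produces many shattered patterns; on the other hand
  a sample of size \<open>ln (card A) / \<beta>\<close> already separates \<open>A\<close>, which bounds the number of patterns
  in terms of the dimension. This gives \<open>ln (card A) \<le> C v ln\<^sup>2 (1 / \<beta>)\<close>, where the logarithms are of order \<open>k\<close>.
  Altogether the entropy at \<open>t\<close> is at most
  \<open>C \<Sum>\<^sub>i \<Sum>\<^sub>k (k + 1)\<^sup>2 v(F, c 2\<^sup>k\<^sup>+\<^sup>i t)\<close>, and the square root of this integrates to a multiple of the dimension
  integral because the weights grow more slowly than \<open>2\<^sup>k\<^sup>+\<^sup>i\<close>.
  
  Lower bound. The uniform measure on a shattered set and a Gilbert-Varshamov family of its subsets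
  give \<open>v(F, t) \<le> 12 D(F, t / 2)\<close>.
  
  The constant is chosen for classes on sets of natural numbers. It is transferred to an
  arbitrary class by collecting countably many witnesses: at each level \<open>n\<close> it suffices to witness a
  countable cofinal set of scales.
\<close>

section \<open>Separated subsets, averages and sums over subsets\<close>

text \<open>Reading \<open>R\<close> as separation, \<open>B\<close> is a separated subset that is
  also a net for \<open>A\<close>. Points are taken one by one, and a point is kept exactly when it
  is separated from all those kept before.\<close>

lemma maximal_separated:
  assumes "finite A" and sym: "\<And>a b. R a b \<Longrightarrow> R b a" and irrefl: "\<And>a. \<not> R a a"
  shows "\<exists>B\<subseteq>A. (\<forall>a\<in>B. \<forall>b\<in>B. a \<noteq> b \<longrightarrow> R a b) \<and> (\<forall>a\<in>A. \<exists>b\<in>B. \<not> R a b)"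
  using assms(1)
proof (induction A rule: finite_induct)
  case empty
  then show ?case by simp
next
  case (insert x A)
  then obtain B where B: "B \<subseteq> A" "\<forall>a\<in>B. \<forall>b\<in>B. a \<noteq> b \<longrightarrow> R a b" "\<forall>a\<in>A. \<exists>b\<in>B. \<not> R a b"
    by blast
  show ?case
  proof (cases "\<exists>b\<in>B. \<not> R x b")
    case True
    then show ?thesis using B by (intro exI[of _ B]) auto
  next
    case False
    then show ?thesis using B sym irrefl by (intro exI[of _ "insert x B"]) (auto; blast)
  qed
qed

text \<open>The clusters around the points of a net cover \<open>A\<close>, so the largest one has
  at least the average size.\<close>

lemma card_le_largest_cluster:
  assumes "finite A" "A \<noteq> {}" "B \<subseteq> A" and cover: "\<forall>a\<in>A. \<exists>b\<in>B. \<not> R a b"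
  obtains b where "b \<in> B" "card A \<le> card B * card {a\<in>A. \<not> R a b}"
proof -
  let ?c = "\<lambda>b. card {a\<in>A. \<not> R a b}"
  have fB: "finite B" using assms finite_subset by blast
  have Bne: "B \<noteq> {}" using assms(2) cover by blast
  then have "Max (?c ` B) \<in> ?c ` B" using fB by (intro Max_in) auto
  then obtain b where b: "b \<in> B" "?c b = Max (?c ` B)" by auto
  have "A = (\<Union>b\<in>B. {a\<in>A. \<not> R a b})" using cover by blast
  then have "card A \<le> (\<Sum>b\<in>B. ?c b)"
    using card_UN_le[OF fB, of "\<lambda>b. {a\<in>A. \<not> R a b}"] by simp
  also have "\<dots> \<le> (\<Sum>_\<in>B. ?c b)" unfolding b(2) using fB by (intro sum_mono) simp
  finally have "card A \<le> card B * ?c b" by simp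
  with b(1) that show ?thesis by blast
qed

lemma weighted_average_le:
  fixes w g :: "'a \<Rightarrow> real"
  assumes "finite X" "\<And>x. x \<in> X \<Longrightarrow> 0 \<le> w x" "sum w X = 1"
  obtains x where "x \<in> X" "g x \<le> (\<Sum>x\<in>X. w x * g x)"
proof -
  have "X \<noteq> {}" using assms(3) by auto
  then have "Min (g ` X) \<in> g ` X" using assms(1) by (intro Min_in) auto
  then obtain x where x: "x \<in> X" "g x = Min (g ` X)" by auto
  have "g x = (\<Sum>y\<in>X. w y * g x)"
    using assms(3) by (simp flip: sum_distrib_right)
  also have "\<dots> \<le> (\<Sum>y\<in>X. w y * g y)"
    using assms x by (intro sum_mono mult_left_mono) auto
  finally show ?thesis using x that by blast
qed

lemma weighted_average_ge:
  fixes w g :: "'a \<Rightarrow> real"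
  assumes "finite X" "\<And>x. x \<in> X \<Longrightarrow> 0 \<le> w x" "sum w X = 1"
  obtains x where "x \<in> X" "(\<Sum>x\<in>X. w x * g x) \<le> g x"
  using weighted_average_le[OF assms, of "\<lambda>x. - g x"] by (auto simp: sum_negf)

text \<open>The binomial theorem with terms indexed by subsets. It sums the exponential weights by
  which both patterns and Hamming balls are counted.\<close>

lemma sum_power_card_Pow:
  fixes a :: real
  assumes "finite X"
  shows "(\<Sum>\<sigma>\<in>Pow X. a ^ card \<sigma>) = (1 + a) ^ card X"
  using assms
proof (induction X rule: finite_induct)
  case (insert x X)
  have inj: "inj_on (insert x) (Pow X)" using insert(2) by (auto simp: inj_on_def)
  have "(\<Sum>\<sigma>\<in>Pow (insert x X). a ^ card \<sigma>)
      = (\<Sum>\<sigma>\<in>Pow X. a ^ card \<sigma>) + (\<Sum>\<sigma>\<in>insert x ` Pow X. a ^ card \<sigma>)"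
    unfolding Pow_insert using insert by (intro sum.union_disjoint) auto
  also have "(\<Sum>\<sigma>\<in>insert x ` Pow X. a ^ card \<sigma>) = (\<Sum>\<sigma>\<in>Pow X. a * a ^ card \<sigma>)"
    unfolding sum.reindex[OF inj] o_def
  proof (intro sum.cong refl)
    fix \<sigma> assume "\<sigma> \<in> Pow X"
    then have "finite \<sigma>" "x \<notin> \<sigma>" using insert finite_subset by auto
    then show "a ^ card (insert x \<sigma>) = a * a ^ card \<sigma>" by simp
  qed
  finally show ?case using insert by (simp add: algebra_simps flip: sum_distrib_left)
qed simp

section \<open>Shattered patterns of integer-valued functions\<close>

text \<open>
  The gap \<open>2\<close> is what survives rounding: if \<open>f\<close> is rounded down to multiples of \<open>s\<close>, then
  integer values differing by \<open>2\<close> come from real values separated by a full step \<open>s\<close>.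
\<close>

definition patterns :: "'a set \<Rightarrow> int set \<Rightarrow> ('a \<Rightarrow> int) set \<Rightarrow> ('a set \<times> ('a \<Rightarrow> int)) set" where
  "patterns X V A = {(\<sigma>, h). \<sigma> \<subseteq> X \<and> h \<in> \<sigma> \<rightarrow>\<^sub>E V \<and>
     (\<forall>\<tau>\<subseteq>\<sigma>. \<exists>f\<in>A. (\<forall>x\<in>\<sigma> - \<tau>. f x \<le> h x) \<and> (\<forall>x\<in>\<tau>. h x + 2 \<le> f x))}"

lemma finite_patterns:
  assumes "finite X" "finite V"
  shows "finite (patterns X V A)"
proof (rule finite_subset)
  show "patterns X V A \<subseteq> (SIGMA \<sigma>:Pow X. \<sigma> \<rightarrow>\<^sub>E V)" by (auto simp: patterns_def)
  show "finite (SIGMA \<sigma>:Pow X. \<sigma> \<rightarrow>\<^sub>E V)"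
    using assms by (intro finite_SigmaI finite_PiE) (auto intro: finite_subset)
qed

lemma patterns_mono: "A \<subseteq> B \<Longrightarrow> patterns X V A \<subseteq> patterns X V B"
  unfolding patterns_def by blast

text \<open>As \<open>z \<le> 1\<close>, the factor \<open>z ^ d\<close> is at most
  \<open>z ^ card \<sigma>\<close> for every admissible \<open>\<sigma>\<close>. After this
  replacement the sum may run over all subsets of \<open>X\<close>, where it has a closed
  form.\<close>

lemma patterns_count:
  fixes z :: real
  assumes fin: "finite X" "finite V" and z: "0 < z" "z \<le> 1"
    and d: "\<And>\<sigma> h. (\<sigma>, h) \<in> patterns X V A \<Longrightarrow> card \<sigma> \<le> d"
  shows "z ^ d * real (card (patterns X V A)) \<le> (1 + real (card V) * z) ^ card X"
proof -
  let ?S = "{\<sigma>\<in>Pow X. card \<sigma> \<le> d}"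
  have fS: "finite ?S" using fin by simp
  have fs: "finite \<sigma>" if "\<sigma> \<in> Pow X" for \<sigma> using that fin finite_subset by auto
  have "card (patterns X V A) \<le> card (SIGMA \<sigma>:?S. \<sigma> \<rightarrow>\<^sub>E V)"
    using fin fS fs d by (intro card_mono finite_SigmaI finite_PiE) (auto simp: patterns_def)
  also have "\<dots> = (\<Sum>\<sigma>\<in>?S. card V ^ card \<sigma>)"
    using fin fs by (subst card_SigmaI) (auto simp: card_PiE intro!: finite_PiE)
  finally have "z ^ d * real (card (patterns X V A)) \<le> z ^ d * (\<Sum>\<sigma>\<in>?S. real (card V) ^ card \<sigma>)"
    using z by (intro mult_left_mono) (auto simp flip: of_nat_sum of_nat_power)
  also have "\<dots> = (\<Sum>\<sigma>\<in>?S. z ^ d * real (card V) ^ card \<sigma>)" by (simp add: sum_distrib_left)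
  also have "\<dots> \<le> (\<Sum>\<sigma>\<in>?S. (real (card V) * z) ^ card \<sigma>)"
  proof (intro sum_mono)
    fix \<sigma> assume "\<sigma> \<in> ?S"
    then have "z ^ d \<le> z ^ card \<sigma>" using z by (intro power_decreasing) auto
    then show "z ^ d * real (card V) ^ card \<sigma> \<le> (real (card V) * z) ^ card \<sigma>"
      by (simp add: power_mult_distrib mult.commute[of "real (card V) ^ card \<sigma>"] mult_right_mono)
  qed
  also have "\<dots> \<le> (\<Sum>\<sigma>\<in>Pow X. (real (card V) * z) ^ card \<sigma>)"
    using fin z by (intro sum_mono2) auto
  also have "\<dots> = (1 + real (card V) * z) ^ card X"
    using fin(1) by (rule sum_power_card_Pow)
  finally show ?thesis .
qed

text \<open>
  A pattern common to \<open>B\<close> and \<open>C\<close> yields one more pattern of \<open>A\<close>, obtained by adding the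
  coordinate \<open>x\<close>, on which no pattern of \<open>B\<close> or \<open>C\<close> can live since these classes are constant there.
\<close>

lemma patterns_card_double:
  assumes fin: "finite X" "finite V" and x: "x \<in> X" and u: "u \<in> V" "u + 2 \<le> v"
    and B: "B \<subseteq> A" "\<And>f. f \<in> B \<Longrightarrow> f x = u" and C: "C \<subseteq> A" "\<And>f. f \<in> C \<Longrightarrow> f x = v"
  shows "card (patterns X V B) + card (patterns X V C) \<le> card (patterns X V A)"
proof -
  let ?P = "patterns X V B" and ?Q = "patterns X V C"
  let ?ext = "\<lambda>(\<sigma>, h). (insert x \<sigma>, h(x := u))"
  have Bu: "\<forall>f\<in>B. f x = u" and Cv: "\<forall>f\<in>C. f x = v" using B C by auto
  have notin: "x \<notin> \<sigma>" if "(\<sigma>, h) \<in> patterns X V D" "\<forall>f\<in>D. f x = c" for \<sigma> h D c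
  proof
    assume "x \<in> \<sigma>"
    have split: "\<forall>\<tau>\<subseteq>\<sigma>. \<exists>f\<in>D. (\<forall>x\<in>\<sigma> - \<tau>. f x \<le> h x) \<and> (\<forall>x\<in>\<tau>. h x + 2 \<le> f x)"
      using that(1) by (auto simp: patterns_def)
    from split[rule_format, of "{}"] that(2) \<open>x \<in> \<sigma>\<close> have "c \<le> h x" by auto
    moreover from split[rule_format, of \<sigma>] that(2) \<open>x \<in> \<sigma>\<close> have "h x + 2 \<le> c" by auto
    ultimately show False by simp
  qed
  have fP: "finite ?P" "finite ?Q" "finite (patterns X V A)" using fin finite_patterns by auto
  have inj: "inj_on ?ext (?P \<inter> ?Q)"
  proof (rule inj_onI, clarify)
    fix \<sigma> h \<sigma>' h'
    assume 1: "(\<sigma>, h) \<in> ?P" and 2: "(\<sigma>', h') \<in> ?P"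
      and eq: "insert x \<sigma> = insert x \<sigma>'" "h(x := u) = h'(x := u)"
    have n: "x \<notin> \<sigma>" "x \<notin> \<sigma>'" using notin[OF 1 Bu] notin[OF 2 Bu] by auto
    then have "\<sigma> = \<sigma>'" using eq(1) by (metis insert_ident)
    \<comment> \<open>Thresholds are extensional, so overwriting the value at \<open>x\<close> loses
      no information.\<close>
    moreover have "h x = undefined" "h' x = undefined"
      using 1 2 n by (auto simp: patterns_def PiE_def extensional_def)
    with eq(2) have "h = h'" by (metis fun_upd_idem_iff fun_upd_upd)
    ultimately show "\<sigma> = \<sigma>' \<and> h = h'" by simp
  qed
  have sub: "?ext ` (?P \<inter> ?Q) \<subseteq> patterns X V A"
  proof clarify
    fix \<sigma> h assume P: "(\<sigma>, h) \<in> ?P" and Q: "(\<sigma>, h) \<in> ?Q"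
    have n: "x \<notin> \<sigma>" using notin[OF P Bu] by auto
    \<comment> \<open>At \<open>x\<close> the threshold is \<open>u\<close>. Members of
      \<open>B\<close> take the value \<open>u\<close> there and serve the patterns with
      \<open>x\<close> below; members of \<open>C\<close> take \<open>v\<close>, at least
      \<open>u + 2\<close>, and serve those with \<open>x\<close> above.\<close>
    have "\<exists>f\<in>A. (\<forall>y\<in>insert x \<sigma> - \<tau>. f y \<le> (h(x := u)) y) \<and> (\<forall>y\<in>\<tau>. (h(x := u)) y + 2 \<le> f y)"
      if \<tau>: "\<tau> \<subseteq> insert x \<sigma>" for \<tau>
    proof -
      have sub': "\<tau> - {x} \<subseteq> \<sigma>" using \<tau> by blast
      show ?thesis
      proof (cases "x \<in> \<tau>")
        case True
        from Q sub' obtain f where "f \<in> C" "\<forall>y\<in>\<sigma> - (\<tau> - {x}). f y \<le> h y"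
          "\<forall>y\<in>\<tau> - {x}. h y + 2 \<le> f y" unfolding patterns_def by blast
        then show ?thesis using C u n True by (intro bexI[of _ f]) auto
      next
        case False
        from P sub' obtain f where "f \<in> B" "\<forall>y\<in>\<sigma> - (\<tau> - {x}). f y \<le> h y"
          "\<forall>y\<in>\<tau> - {x}. h y + 2 \<le> f y" unfolding patterns_def by blast
        then show ?thesis using B u n False by (intro bexI[of _ f]) auto
      qed
    qed
    moreover have "h \<in> \<sigma> \<rightarrow>\<^sub>E V" "insert x \<sigma> \<subseteq> X"
      using P x by (auto simp: patterns_def)
    moreover from this(1) have "h(x := u) \<in> insert x \<sigma> \<rightarrow>\<^sub>E V"
      using u(1) by (intro PiE_fun_upd)
    ultimately show "(insert x \<sigma>, h(x := u)) \<in> patterns X V A" by (simp add: patterns_def)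
  qed
  have "x \<in> fst (?ext q)" for q by (cases q) simp
  then have ext: "\<forall>q\<in>?ext ` (?P \<inter> ?Q). x \<in> fst q" by blast
  have "x \<notin> fst q" if "q \<in> ?P \<union> ?Q" for q
    using that notin[OF _ Bu] notin[OF _ Cv] by (cases q) auto
  with ext have disj: "(?P \<union> ?Q) \<inter> ?ext ` (?P \<inter> ?Q) = {}" by blast
  have "card ?P + card ?Q = card (?P \<union> ?Q) + card (?P \<inter> ?Q)"
    using fP(1,2) by (rule card_Un_Int)
  also have "\<dots> = card (?P \<union> ?Q) + card (?ext ` (?P \<inter> ?Q))"
    using inj by (simp add: card_image)
  also have "\<dots> = card ((?P \<union> ?Q) \<union> ?ext ` (?P \<inter> ?Q))"
    using fP disj by (intro card_Un_disjoint[symmetric]) auto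
  also have "\<dots> \<le> card (patterns X V A)"
    using fP sub patterns_mono[OF B(1)] patterns_mono[OF C(1)] by (intro card_mono) auto
  finally show ?thesis .
qed

text \<open>Averaging over \<open>x\<close> yields a coordinate at which at least
  \<open>\<beta> N^2 / 2\<close> ordered pairs differ by \<open>2\<close>, where \<open>N\<close> is
  \<open>card A\<close>. Grouping these pairs by their two values, one of the at most
  \<open>(card V)^2\<close> value pairs receives its share; bounding one of the two class sizes by
  \<open>N\<close> makes the other large.\<close>

lemma value_pair_pigeonhole:
  fixes w :: "'a \<Rightarrow> real" and A :: "('a \<Rightarrow> int) set" and \<beta> :: real
  assumes fin: "finite X" "finite V" "finite A"
    and w: "\<And>x. x \<in> X \<Longrightarrow> 0 \<le> w x" "sum w X = 1"
    and V: "\<And>f x. f \<in> A \<Longrightarrow> x \<in> X \<Longrightarrow> f x \<in> V"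
    and sep: "\<And>f g. f \<in> A \<Longrightarrow> g \<in> A \<Longrightarrow> f \<noteq> g \<Longrightarrow> \<beta> \<le> (\<Sum>x\<in>X. w x * of_bool (2 \<le> \<bar>f x - g x\<bar>))"
    and \<beta>: "0 < \<beta>" and A: "2 \<le> card A"
  obtains x u v where "x \<in> X" "u \<in> V" "u + 2 \<le> v"
    "\<beta> * real (card A) \<le> 2 * (real (card V))\<^sup>2 * real (card {f\<in>A. f x = u})"
    "\<beta> * real (card A) \<le> 2 * (real (card V))\<^sup>2 * real (card {f\<in>A. f x = v})"
proof -
  let ?N = "real (card A)" and ?p = "real (card V)"
  let ?I = "\<lambda>x f g. of_bool (2 \<le> \<bar>f x - g x\<bar>) :: real"
  define c where "c = (\<lambda>x. \<Sum>f\<in>A. \<Sum>g\<in>A. ?I x f g)"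
  define n where "n = (\<lambda>x u. real (card {f\<in>A. f x = u}))"
  obtain x where x: "x \<in> X" "(\<Sum>x\<in>X. w x * c x) \<le> c x"
    using weighted_average_ge[OF fin(1) w] by blast
  \<comment> \<open>Only pairs of distinct functions are separated; there are
    \<open>N (N - 1)\<close> of them, at least \<open>N^2 / 2\<close> because \<open>N\<close> is at
    least \<open>2\<close>.\<close>
  have "\<beta> * ?N\<^sup>2 / 2 \<le> \<beta> * (?N * (?N - 1))"
    using A \<beta> by (simp add: power2_eq_square field_simps)
  also have "\<dots> = (\<Sum>f\<in>A. \<Sum>g\<in>A. if f \<noteq> g then \<beta> else 0)"
  proof -
    have "(\<Sum>g\<in>A. if f \<noteq> g then \<beta> else 0) = (?N - 1) * \<beta>" if "f \<in> A" for f
    proof -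
      have "(\<Sum>g\<in>A. if f \<noteq> g then \<beta> else 0) = (\<Sum>g\<in>A - {f}. \<beta>)"
        using fin by (intro sum.mono_neutral_cong_right) auto
      then show ?thesis using fin that A by (simp add: card_Diff_singleton)
    qed
    then show ?thesis by simp
  qed
  also have "\<dots> \<le> (\<Sum>f\<in>A. \<Sum>g\<in>A. \<Sum>x\<in>X. w x * ?I x f g)"
    using sep w by (intro sum_mono) (auto intro!: sum_nonneg)
  also have "\<dots> = (\<Sum>x\<in>X. w x * c x)"
  proof -
    have "(\<Sum>x\<in>X. w x * c x) = (\<Sum>x\<in>X. \<Sum>f\<in>A. \<Sum>g\<in>A. w x * ?I x f g)"
      unfolding c_def by (simp only: sum_distrib_left)
    also have "\<dots> = (\<Sum>f\<in>A. \<Sum>x\<in>X. \<Sum>g\<in>A. w x * ?I x f g)" by (rule sum.swap)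
    also have "\<dots> = (\<Sum>f\<in>A. \<Sum>g\<in>A. \<Sum>x\<in>X. w x * ?I x f g)"
      by (intro sum.cong refl sum.swap)
    finally show ?thesis by simp
  qed
  also have "\<dots> \<le> c x" by (rule x(2))
  finally have cx: "\<beta> * ?N\<^sup>2 / 2 \<le> c x" .
  have cx_eq: "c x = (\<Sum>u\<in>V. \<Sum>v\<in>V. if 2 \<le> \<bar>u - v\<bar> then n x u * n x v else 0)"
  proof -
    have one: "(\<Sum>v\<in>V. of_bool (y = v) * q v) = q y" if "y \<in> V" for y and q :: "int \<Rightarrow> real"
    proof -
      have "(\<Sum>v\<in>V. of_bool (y = v) * q v) = (\<Sum>v\<in>V. if v = y then q v else 0)"
        by (intro sum.cong) auto
      then show ?thesis using that fin by simp
    qed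
    have xV: "g x \<in> V" if "g \<in> A" for g using V[OF that x(1)] .
    have n: "n x u = (\<Sum>f\<in>A. of_bool (f x = u))" for u
      unfolding n_def using fin by (simp add: of_bool_def sum.If_cases Int_def)
    have "(\<Sum>u\<in>V. \<Sum>v\<in>V. if 2 \<le> \<bar>u - v\<bar> then n x u * n x v else 0)
        = (\<Sum>u\<in>V. \<Sum>v\<in>V. \<Sum>f\<in>A. \<Sum>g\<in>A. of_bool (f x = u) * (of_bool (g x = v) * of_bool (2 \<le> \<bar>u - v\<bar>)))"
      unfolding n by (intro sum.cong refl) (auto simp: sum_product)
    also have "\<dots> = (\<Sum>u\<in>V. \<Sum>f\<in>A. \<Sum>g\<in>A. \<Sum>v\<in>V. of_bool (f x = u) * (of_bool (g x = v) * of_bool (2 \<le> \<bar>u - v\<bar>)))"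
      by (intro sum.cong refl, subst sum.swap, intro sum.cong refl sum.swap)
    also have "\<dots> = (\<Sum>u\<in>V. \<Sum>f\<in>A. \<Sum>g\<in>A. of_bool (f x = u) * of_bool (2 \<le> \<bar>u - g x\<bar>))"
    proof (intro sum.cong refl)
      fix u f g assume g: "g \<in> A"
      show "(\<Sum>v\<in>V. of_bool (f x = u) * (of_bool (g x = v) * of_bool (2 \<le> \<bar>u - v\<bar>)))
          = (of_bool (f x = u) * of_bool (2 \<le> \<bar>u - g x\<bar>) :: real)"
        using one[OF xV[OF g], of "\<lambda>v. of_bool (2 \<le> \<bar>u - v\<bar>)"] by (simp only: sum_distrib_left[symmetric])
    qed
    also have "\<dots> = (\<Sum>f\<in>A. \<Sum>g\<in>A. \<Sum>u\<in>V. of_bool (f x = u) * of_bool (2 \<le> \<bar>u - g x\<bar>))"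
      by (subst sum.swap, intro sum.cong refl sum.swap)
    also have "\<dots> = c x" unfolding c_def
    proof (intro sum.cong refl)
      fix f g assume f: "f \<in> A"
      show "(\<Sum>u\<in>V. of_bool (f x = u) * of_bool (2 \<le> \<bar>u - g x\<bar>)) = ?I x f g"
        using one[OF xV[OF f], of "\<lambda>u. of_bool (2 \<le> \<bar>u - g x\<bar>)"] by simp
    qed
    finally show ?thesis by simp
  qed
  obtain u v where uv: "u \<in> V" "v \<in> V" "2 \<le> \<bar>u - v\<bar>" "\<beta> * ?N\<^sup>2 \<le> 2 * ?p\<^sup>2 * (n x u * n x v)"
  proof -
    have False if H: "\<And>u v. u \<in> V \<Longrightarrow> v \<in> V \<Longrightarrow> 2 \<le> \<bar>u - v\<bar> \<Longrightarrow> 2 * ?p\<^sup>2 * (n x u * n x v) < \<beta> * ?N\<^sup>2"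
    proof -
      have Vne: "V \<noteq> {}" using A V x(1) by fastforce
      then have p: "0 < ?p" using fin by (simp add: card_gt_0_iff)
      have "c x < (\<Sum>u\<in>V. \<Sum>v\<in>V. \<beta> * ?N\<^sup>2 / (2 * ?p\<^sup>2))"
        unfolding cx_eq
      proof (intro sum_strict_mono fin Vne)
        fix u v assume uv: "u \<in> V" "v \<in> V"
        have "n x u * n x v < \<beta> * ?N\<^sup>2 / (2 * ?p\<^sup>2)" if "2 \<le> \<bar>u - v\<bar>"
          using H[OF uv that] p by (simp add: field_simps)
        moreover have "0 < \<beta> * ?N\<^sup>2 / (2 * ?p\<^sup>2)" using p \<beta> A by simp
        ultimately show "(if 2 \<le> \<bar>u - v\<bar> then n x u * n x v else 0) < \<beta> * ?N\<^sup>2 / (2 * ?p\<^sup>2)"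
          by auto
      qed
      also have "\<dots> = \<beta> * ?N\<^sup>2 / 2" using p by (simp add: power2_eq_square)
      finally show False using cx by simp
    qed
    then show ?thesis using that by (meson not_less)
  qed
  have n_le: "n x u \<le> ?N" for u unfolding n_def using fin by (simp add: card_mono)
  have large: "\<beta> * ?N \<le> 2 * ?p\<^sup>2 * n x a" if "\<beta> * ?N\<^sup>2 \<le> 2 * ?p\<^sup>2 * (n x a * n x b)" for a b
  proof -
    have "n x a * n x b \<le> n x a * ?N" using n_le by (intro mult_left_mono) (auto simp: n_def)
    then have "2 * ?p\<^sup>2 * (n x a * n x b) \<le> 2 * ?p\<^sup>2 * (n x a * ?N)" by (rule mult_left_mono) simp
    with that have "(\<beta> * ?N) * ?N \<le> (2 * ?p\<^sup>2 * n x a) * ?N"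
      by (simp add: power2_eq_square mult.assoc)
    then show ?thesis using A by (subst (asm) mult_le_cancel_right) auto
  qed
  show ?thesis
  proof (cases "u + 2 \<le> v")
    case True
    show ?thesis
      using that[of x u v] x uv True large[of u v] large[of v u] by (simp add: n_def mult.commute)
  next
    case False
    then show ?thesis
      using that[of x v u] x uv large[of u v] large[of v u] by (simp add: n_def mult.commute)
  qed
qed

text \<open>Each round finds two subclasses that are constant at a common coordinate and smaller
  than \<open>A\<close> by at most the factor \<open>2 (card V)^2 / \<beta>\<close>. Their pattern
  counts add up, so each such factor in \<open>card A\<close> doubles the number of
  patterns.\<close>

lemma patterns_card_ge:
  fixes w :: "'a \<Rightarrow> real" and A :: "('a \<Rightarrow> int) set" and \<beta> :: real
  assumes fin: "finite X" "finite V" "V \<noteq> {}"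
    and w: "\<And>x. x \<in> X \<Longrightarrow> 0 \<le> w x" "sum w X = 1"
    and \<beta>: "0 < \<beta>" "\<beta> \<le> 1"
    and A: "finite A" "\<And>f x. f \<in> A \<Longrightarrow> x \<in> X \<Longrightarrow> f x \<in> V"
      "\<And>f g. f \<in> A \<Longrightarrow> g \<in> A \<Longrightarrow> f \<noteq> g \<Longrightarrow> \<beta> \<le> (\<Sum>x\<in>X. w x * of_bool (2 \<le> \<bar>f x - g x\<bar>))"
    and card: "(2 * (real (card V))\<^sup>2 / \<beta>) ^ r \<le> real (card A)"
  shows "2 ^ r \<le> card (patterns X V A)"
  using A card
proof (induction r arbitrary: A)
  case 0
  then obtain f where "f \<in> A" by fastforce
  \<comment> \<open>The empty pattern belongs to every nonempty class.\<close>
  then have "({}, \<lambda>_. undefined) \<in> patterns X V A" by (auto simp: patterns_def)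
  then have "0 < card (patterns X V A)"
    using finite_patterns[OF fin(1,2)] by (auto simp: card_gt_0_iff)
  then show ?case by simp
next
  case (Suc r)
  define K where "K = 2 * (real (card V))\<^sup>2 / \<beta>"
  have "1 \<le> card V" using fin by (simp add: Suc_le_eq card_gt_0_iff)
  then have "1 \<le> (real (card V))\<^sup>2" by simp
  then have K: "2 \<le> K" using \<beta> by (simp add: K_def field_simps)
  have "2 \<le> K ^ Suc r"
    using K one_le_power[of K r] mult_mono[of 2 K 1 "K ^ r"] by simp
  then have A2: "2 \<le> card A" using Suc.prems(4) by (simp add: K_def)
  obtain x u v where x: "x \<in> X" "u \<in> V" "u + 2 \<le> v"
    and large: "\<beta> * real (card A) \<le> 2 * (real (card V))\<^sup>2 * real (card {f\<in>A. f x = u})"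
    "\<beta> * real (card A) \<le> 2 * (real (card V))\<^sup>2 * real (card {f\<in>A. f x = v})"
    by (rule value_pair_pigeonhole[of X V A w \<beta>]) (use fin w Suc.prems \<beta> A2 in auto)
  have IH: "2 ^ r \<le> card (patterns X V {f\<in>A. f x = a})"
    if "\<beta> * real (card A) \<le> 2 * (real (card V))\<^sup>2 * real (card {f\<in>A. f x = a})" for a
  proof (rule Suc.IH)
    have "K * K ^ r \<le> real (card A)" using Suc.prems(4) by (simp add: K_def)
    also have "\<dots> \<le> K * real (card {f\<in>A. f x = a})"
      using that \<beta> by (simp add: K_def field_simps)
    finally show "(2 * (real (card V))\<^sup>2 / \<beta>) ^ r \<le> real (card {f\<in>A. f x = a})"
      using K by (simp add: K_def[symmetric])
  qed (use Suc.prems in auto)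
  have "card (patterns X V {f\<in>A. f x = u}) + card (patterns X V {f\<in>A. f x = v}) \<le> card (patterns X V A)"
    by (rule patterns_card_double[OF fin(1,2) x]) auto
  with IH[OF large(1)] IH[OF large(2)] show ?case unfolding power_Suc by linarith
qed

section \<open>Entropy of bounded integer-valued classes\<close>

text \<open>
  Derandomised sampling, in place of a Chernoff bound: each new point is chosen so that the potential
  on the left decreases at least as much as on average.
\<close>

lemma sample_potential:
  fixes w :: "'a \<Rightarrow> real" and S :: "'i \<Rightarrow> 'a set" and \<beta> :: real
  assumes fin: "finite X" "finite P" and w: "\<And>x. x \<in> X \<Longrightarrow> 0 \<le> w x" "sum w X = 1"
    and \<beta>: "\<beta> \<le> 1"
    and S: "\<And>i. i \<in> P \<Longrightarrow> \<beta> \<le> (\<Sum>x\<in>X. w x * of_bool (x \<in> S i))"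
  shows "\<exists>xs. length xs = m \<and> set xs \<subseteq> X \<and>
    (\<Sum>i\<in>P. (1/2) ^ length (filter (\<lambda>x. x \<in> S i) xs)) \<le> real (card P) * (1 - \<beta> / 2) ^ m"
proof (induction m)
  case (Suc m)
  then obtain xs where xs: "length xs = m" "set xs \<subseteq> X"
    "(\<Sum>i\<in>P. (1/2) ^ length (filter (\<lambda>x. x \<in> S i) xs)) \<le> real (card P) * (1 - \<beta> / 2) ^ m" by blast
  \<comment> \<open>\<open>W i\<close> is the current weight of \<open>i\<close>. A new point in
    \<open>S i\<close> halves it, so on average the weight shrinks at least by the factor
    \<open>1 - \<beta> / 2\<close>; \<open>g x\<close> is the potential once \<open>x\<close> has
    been added.\<close>
  define W :: "'i \<Rightarrow> real" where "W = (\<lambda>i. (1/2) ^ length (filter (\<lambda>x. x \<in> S i) xs))"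
  define g where "g = (\<lambda>x. \<Sum>i\<in>P. W i * (1 - of_bool (x \<in> S i) / 2))"
  obtain x where x: "x \<in> X" "g x \<le> (\<Sum>x\<in>X. w x * g x)"
    using weighted_average_le[OF fin(1) w] by blast
  have "(\<Sum>i\<in>P. (1/2) ^ length (filter (\<lambda>x. x \<in> S i) (x # xs))) = g x"
    unfolding g_def W_def by (intro sum.cong) auto
  also have "g x \<le> (\<Sum>x\<in>X. w x * g x)" by (rule x)
  also have "\<dots> = (\<Sum>i\<in>P. W i * (\<Sum>x\<in>X. w x * (1 - of_bool (x \<in> S i) / 2)))"
  proof -
    have "(\<Sum>x\<in>X. w x * g x) = (\<Sum>x\<in>X. \<Sum>i\<in>P. W i * (w x * (1 - of_bool (x \<in> S i) / 2)))"
      unfolding g_def by (simp only: sum_distrib_left mult.left_commute)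
    also have "\<dots> = (\<Sum>i\<in>P. \<Sum>x\<in>X. W i * (w x * (1 - of_bool (x \<in> S i) / 2)))" by (rule sum.swap)
    finally show ?thesis by (simp only: sum_distrib_left)
  qed
  also have "\<dots> \<le> (\<Sum>i\<in>P. W i * (1 - \<beta> / 2))"
  proof (intro sum_mono mult_left_mono)
    fix i assume "i \<in> P"
    have "(\<Sum>x\<in>X. w x * (1 - of_bool (x \<in> S i) / 2)) = 1 - (\<Sum>x\<in>X. w x * of_bool (x \<in> S i)) / 2"
      using w(2) by (simp add: right_diff_distrib sum_subtractf sum_divide_distrib)
    then show "(\<Sum>x\<in>X. w x * (1 - of_bool (x \<in> S i) / 2)) \<le> 1 - \<beta> / 2"
      using S[OF \<open>i \<in> P\<close>] by simp
  qed (simp add: W_def)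
  also have "\<dots> \<le> real (card P) * (1 - \<beta> / 2) ^ m * (1 - \<beta> / 2)"
    using xs(3) \<beta> unfolding W_def sum_distrib_right[symmetric] by (intro mult_right_mono) auto
  finally have "(\<Sum>i\<in>P. (1/2) ^ length (filter (\<lambda>x. x \<in> S i) (x # xs)))
      \<le> real (card P) * (1 - \<beta> / 2) ^ Suc m" by (simp only: power_Suc2 mult.assoc)
  moreover have "length (x # xs) = Suc m" "set (x # xs) \<subseteq> X" using xs x by auto
  ultimately show ?case by blast
qed auto

text \<open>Divided by the length of \<open>xs\<close>, this is the probability of \<open>Q\<close>
  under the empirical measure of a sample with repetitions.\<close>

lemma sum_count_list_filter:
  assumes "finite X" "set xs \<subseteq> X"
  shows "(\<Sum>x\<in>X. real (count_list xs x) * of_bool (Q x)) = real (length (filter Q xs))"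
  using assms(2)
proof (induction xs)
  case (Cons y xs)
  have "(\<Sum>x\<in>X. real (count_list (y # xs) x) * of_bool (Q x))
      = (\<Sum>x\<in>X. real (count_list xs x) * of_bool (Q x) + (if x = y then of_bool (Q x) else 0))"
    by (intro sum.cong refl) (simp add: distrib_right)
  also have "\<dots> = real (length (filter Q xs)) + of_bool (Q y)"
    unfolding sum.distrib using Cons assms(1) by simp
  finally show ?case by simp
qed simp

lemma patterns_mono_domain: "X \<subseteq> Y \<Longrightarrow> patterns X V A \<subseteq> patterns Y V A"
  unfolding patterns_def by blast

text \<open>The potential runs over all ordered pairs of distinct functions, of which there are at
  most \<open>(card A)^2\<close>. The weights \<open>w'\<close> are the empirical measure of the
  sample.\<close>

lemma sample_separated:
  fixes w :: "'a \<Rightarrow> real" and A :: "('a \<Rightarrow> int) set" and \<beta> :: real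
  assumes fin: "finite X" "finite A"
    and w: "\<And>x. x \<in> X \<Longrightarrow> 0 \<le> w x" "sum w X = 1"
    and \<beta>: "0 < \<beta>" "\<beta> \<le> 1"
    and sep: "\<And>f g. f \<in> A \<Longrightarrow> g \<in> A \<Longrightarrow> f \<noteq> g \<Longrightarrow> \<beta> \<le> (\<Sum>x\<in>X. w x * of_bool (2 \<le> \<bar>f x - g x\<bar>))"
    and A2: "2 \<le> card A"
  obtains Y w' where "Y \<subseteq> X" "real (card Y) \<le> 10 * ln (card A) / \<beta>"
    "\<And>x. x \<in> Y \<Longrightarrow> 0 \<le> w' x" "sum w' Y = (1::real)"
    "\<And>f g. f \<in> A \<Longrightarrow> g \<in> A \<Longrightarrow> f \<noteq> g \<Longrightarrow> \<beta> / 4 \<le> (\<Sum>x\<in>Y. w' x * of_bool (2 \<le> \<bar>f x - g x\<bar>))"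
proof -
  define L where "L = ln (real (card A))"
  have "ln 2 \<le> L" using A2 by (simp add: L_def)
  then have L: "1 / 2 \<le> L" using ln2_ge_two_thirds by simp
  \<comment> \<open>With \<open>\<beta> * real m\<close> at least \<open>8 * L\<close>, the number
    of pairs costs \<open>2 * L\<close>, at most half of the gain
    \<open>\<beta> * real m / 2\<close>; what remains is
    \<open>\<beta> * real m / 4\<close>.\<close>
  define m where "m = nat \<lceil>8 * L / \<beta>\<rceil>"
  have m: "8 * L / \<beta> \<le> real m" "real m \<le> 8 * L / \<beta> + 1"
    using L \<beta> by (auto simp: m_def) 
  have "1 \<le> 2 * L / \<beta>" using L \<beta> by (simp add: field_simps)
  then have m10: "real m \<le> 10 * L / \<beta>" using m(2) \<beta> by (simp add: field_simps)
  have "0 < 8 * L / \<beta>" using L \<beta> by simp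
  then have m0: "0 < m" using m(1) by linarith
  have mL: "8 * L \<le> \<beta> * real m" using m(1) \<beta> by (simp add: field_simps)
  define P where "P = {(f, g) \<in> A \<times> A. f \<noteq> g}"
  define S where "S = (\<lambda>(f :: 'a \<Rightarrow> int, g). {x. 2 \<le> \<bar>f x - g x\<bar>})"
  have finP: "finite P" unfolding P_def using fin by (auto intro: finite_subset[of _ "A \<times> A"])
  have "card P \<le> card (A \<times> A)" unfolding P_def using fin by (intro card_mono) auto
  then have cardP: "real (card P) \<le> exp (2 * L)"
    using A2 by (simp add: card_cartesian_product L_def exp_double power2_eq_square flip: of_nat_mult)
  have "\<And>i. i \<in> P \<Longrightarrow> \<beta> \<le> (\<Sum>x\<in>X. w x * of_bool (x \<in> S i))"
    using sep by (auto simp: P_def S_def)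
  from sample_potential[where P=P and S=S and X=X and w=w and \<beta>=\<beta>, OF fin(1) finP w \<beta>(2) this, of m]
  obtain xs where xs: "length xs = m" "set xs \<subseteq> X"
    and pot: "(\<Sum>i\<in>P. (1/2) ^ length (filter (\<lambda>x. x \<in> S i) xs)) \<le> real (card P) * (1 - \<beta> / 2) ^ m"
    by auto
  have cnt: "\<beta> / 4 * real m \<le> real (length (filter (\<lambda>x. x \<in> S i) xs))" if "i \<in> P" for i
  proof -
    \<comment> \<open>The term of a single pair is at most the whole potential, which forces its
      number of hits \<open>?c\<close> to be large.\<close>
    let ?c = "length (filter (\<lambda>x. x \<in> S i) xs)"
    have "exp (- (real ?c * ln 2)) = (1/2) ^ ?c"
      by (simp add: exp_minus exp_of_nat_mult power_one_over inverse_eq_divide)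
    also have "\<dots> \<le> (\<Sum>i\<in>P. (1/2) ^ length (filter (\<lambda>x. x \<in> S i) xs))"
      using that finP by (intro member_le_sum) auto
    also have "\<dots> \<le> real (card P) * (1 - \<beta> / 2) ^ m" by (rule pot)
    also have "\<dots> \<le> exp (2 * L) * exp (- \<beta> / 2) ^ m"
      using \<beta> exp_ge_add_one_self[of "- \<beta> / 2"] by (intro mult_mono cardP power_mono) auto
    also have "\<dots> = exp (2 * L - real m * \<beta> / 2)"
      by (simp add: exp_of_nat_mult[symmetric] flip: exp_add)
    finally have "real m * \<beta> / 2 - 2 * L \<le> real ?c * ln 2" by simp
    also have "\<dots> \<le> real ?c * 1" using ln_2_less_1 by (intro mult_left_mono) auto
    finally show ?thesis using mL by (simp add: mult.commute)
  qed
  define w' where "w' = (\<lambda>x. real (count_list xs x) / real m)"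
  have w'_sum: "(\<Sum>x\<in>set xs. w' x * of_bool (Q x)) = real (length (filter Q xs)) / real m" for Q
    unfolding w'_def using sum_count_list_filter[of "set xs" xs Q]
    by (simp flip: sum_divide_distrib)
  show ?thesis
  proof (rule that[of "set xs" w'])
    show "real (card (set xs)) \<le> 10 * ln (card A) / \<beta>"
      using card_length[of xs] m10 xs(1) by (simp add: L_def)
    show "sum w' (set xs) = 1" using w'_sum[of "\<lambda>_. True"] xs(1) m0 by simp
    show "\<beta> / 4 \<le> (\<Sum>x\<in>set xs. w' x * of_bool (2 \<le> \<bar>f x - g x\<bar>))"
      if "f \<in> A" "g \<in> A" "f \<noteq> g" for f g
      using cnt[of "(f, g)"] that m0 unfolding w'_sum by (simp add: P_def S_def field_simps)
  qed (use xs in \<open>auto simp: w'_def\<close>)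
qed

text \<open>
  Sampling comes first because the counting bound \<open>patterns_count\<close> depends on the number of points;
  after it this number is of order \<open>ln (card A) / \<beta>\<close>, and the free parameter \<open>z\<close> of that bound is chosen
  so that its contribution is absorbed into the left-hand side.
\<close>

lemma ln_card_le_patterns_dim:
  fixes w :: "'a \<Rightarrow> real" and A :: "('a \<Rightarrow> int) set" and \<beta> :: real
  assumes fin: "finite X" "finite V" "V \<noteq> {}" "finite A"
    and w: "\<And>x. x \<in> X \<Longrightarrow> 0 \<le> w x" "sum w X = 1"
    and \<beta>: "0 < \<beta>" "\<beta> \<le> 1"
    and val: "\<And>f x. f \<in> A \<Longrightarrow> x \<in> X \<Longrightarrow> f x \<in> V"
    and sep: "\<And>f g. f \<in> A \<Longrightarrow> g \<in> A \<Longrightarrow> f \<noteq> g \<Longrightarrow> \<beta> \<le> (\<Sum>x\<in>X. w x * of_bool (2 \<le> \<bar>f x - g x\<bar>))"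
    and d: "1 \<le> d" "\<And>\<sigma> h. (\<sigma>, h) \<in> patterns X V A \<Longrightarrow> card \<sigma> \<le> d"
  shows "ln (card A) \<le> 14 * real d * (ln (8 * (real (card V))\<^sup>2 / \<beta>))\<^sup>2"
proof (cases "2 \<le> card A")
  case False
  then have "card A = 0 \<or> card A = 1" by auto
  then show ?thesis by auto
next
  case True
  obtain Y w' where Y: "Y \<subseteq> X" "real (card Y) \<le> 10 * ln (card A) / \<beta>"
    and w': "\<And>x. x \<in> Y \<Longrightarrow> 0 \<le> w' x" "sum w' Y = (1::real)"
    and sep': "\<And>f g. f \<in> A \<Longrightarrow> g \<in> A \<Longrightarrow> f \<noteq> g \<Longrightarrow> \<beta> / 4 \<le> (\<Sum>x\<in>Y. w' x * of_bool (2 \<le> \<bar>f x - g x\<bar>))"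
    by (rule sample_separated[OF fin(1,4) w \<beta> sep True]) blast+
  have finY: "finite Y" using Y(1) fin(1) finite_subset by auto
  define L where "L = ln (real (card A))"
  define p where "p = real (card V)"
  define K where "K = 8 * p\<^sup>2 / \<beta>"
  have L: "0 < L" using True by (simp add: L_def)
  have p: "1 \<le> p" using fin by (simp add: p_def Suc_le_eq card_gt_0_iff)
  have p2: "p \<le> p\<^sup>2" using p by (simp add: power2_eq_square)
  have K8p: "8 * p / \<beta> \<le> K" unfolding K_def using \<beta> p2 by (simp add: divide_right_mono)
  have "8 \<le> 8 * p / \<beta>" using p \<beta> by (simp add: field_simps)
  then have K8: "8 \<le> K" using K8p by linarith
  have "ln (8::real) = 3 * ln 2" using ln_realpow[of 2 3] by simp
  then have "1 \<le> ln (8::real)" using ln2_ge_two_thirds by simp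
  also have "ln 8 \<le> ln K" using K8 by simp
  finally have lnK: "1 \<le> ln K" .
  \<comment> \<open>\<open>K\<close> is the splitting factor of \<open>patterns_card_ge\<close> for
    separation probability \<open>\<beta> / 4\<close>, and \<open>r\<close> is the largest number of
    rounds with \<open>K ^ r\<close> at most \<open>card A\<close>.\<close>
  define r where "r = nat \<lfloor>L / ln K\<rfloor>"
  have r: "real r \<le> L / ln K" "L / ln K - 1 \<le> real r" using L lnK by (auto simp: r_def)
  have "K ^ r = exp (real r * ln K)" using K8 by (simp add: exp_of_nat_mult)
  also have "\<dots> \<le> exp L" using r(1) lnK by (simp add: field_simps)
  also have "\<dots> = real (card A)" using True by (simp add: L_def)
  finally have "(2 * (real (card V))\<^sup>2 / (\<beta> / 4)) ^ r \<le> real (card A)" by (simp add: K_def p_def)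
  then have pat: "2 ^ r \<le> card (patterns Y V A)"
    using val Y(1) \<beta> by (intro patterns_card_ge[OF finY fin(2,3) w' _ _ fin(4) _ sep']) auto
  \<comment> \<open>With this \<open>z\<close> the exponent \<open>real (card Y) * (p * z)\<close>
    is at most \<open>L / ln K / 4\<close>, whereas \<open>real r * ln 2\<close> is at least
    \<open>L / ln K / 2 - 1 / 2\<close>.\<close>
  define z where "z = \<beta> / (40 * p * ln K)"
  have pl: "1 \<le> p * ln K" using p lnK mult_mono[of 1 p 1 "ln K"] by simp
  have z0: "0 < z" using \<beta> p lnK by (simp add: z_def)
  have z1: "z \<le> 1" using \<beta> pl by (simp add: z_def)
  have "z ^ d * 2 ^ r \<le> z ^ d * real (card (patterns Y V A))"
  proof (rule mult_left_mono)
    have "real (2 ^ r) \<le> real (card (patterns Y V A))" using pat by (rule of_nat_mono)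
    then show "2 ^ r \<le> real (card (patterns Y V A))" by simp
  qed (use z0 in simp)
  also have "\<dots> \<le> (1 + p * z) ^ card Y"
    unfolding p_def using patterns_mono_domain[OF Y(1)] d(2)
    by (intro patterns_count finY fin z0 z1) blast
  also have "\<dots> \<le> exp (p * z) ^ card Y"
    using z0 p by (intro power_mono) auto
  also have "\<dots> = exp (real (card Y) * (p * z))" by (simp add: exp_of_nat_mult)
  also have "\<dots> \<le> exp (10 * L / \<beta> * (p * z))"
    using mult_right_mono[OF Y(2), of "p * z"] z0 p by (simp add: L_def)
  also have "10 * L / \<beta> * (p * z) = L / ln K / 4"
    using \<beta> p lnK by (simp add: z_def field_simps)
  finally have "exp (ln (z ^ d * 2 ^ r)) \<le> exp (L / ln K / 4)"
    using z0 by simp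
  then have "ln (z ^ d * 2 ^ r) \<le> L / ln K / 4" by simp
  moreover have "ln (z ^ d * 2 ^ r) = real d * ln z + real r * ln 2"
    using z0 by (simp add: ln_mult ln_realpow)
  ultimately have 1: "real d * ln z + real r * ln 2 \<le> L / ln K / 4" by simp
  have "real r / 2 \<le> real r * ln 2" using mult_left_mono[of "1 / 2" "ln 2" "real r"] ln2_ge_two_thirds by simp
  with 1 r(2) have "L / ln K / 4 \<le> 1 / 2 - real d * ln z" by linarith
  then have 2: "L \<le> ln K * (2 - 4 * (real d * ln z))" using lnK by (simp add: field_simps)
  have "- ln z = ln (40 * p * ln K / \<beta>)"
    unfolding z_def using \<beta> p lnK by (simp add: ln_div ln_mult)
  also have "\<dots> \<le> ln (K ^ 3)"
  proof -
    \<comment> \<open>The argument of the logarithm is \<open>5 * (8 * p / \<beta>) * ln K\<close>,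
      and each of the three factors is at most \<open>K\<close>.\<close>
    have "ln K \<le> K" using K8 ln_le_minus_one[of K] by linarith
    then have "40 * p * ln K / \<beta> \<le> 5 * (8 * p / \<beta>) * K"
      using \<beta> p by (simp add: field_simps mult_left_mono)
    also have "\<dots> \<le> K * K * K"
      using K8 K8p p \<beta> by (intro mult_mono) auto
    also have "\<dots> = K ^ 3" by (simp add: power3_eq_cube)
    finally show ?thesis using \<beta> p lnK K8 by (subst ln_le_cancel_iff) auto
  qed
  also have "\<dots> = 3 * ln K" using K8 by (simp add: ln_realpow)
  finally have "real d * (- ln z) \<le> real d * (3 * ln K)" by (intro mult_left_mono) auto
  \<comment> \<open>This absorbs the additive \<open>2\<close> into the main term:
    \<open>12 + 2 = 14\<close>.\<close>
  moreover have "1 \<le> real d * ln K" using lnK d(1) mult_mono[of 1 "real d" 1 "ln K"] by simp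
  ultimately have "2 - 4 * (real d * ln z) \<le> 14 * (real d * ln K)" by simp
  then have "ln K * (2 - 4 * (real d * ln z)) \<le> ln K * (14 * (real d * ln K))"
    using lnK by (intro mult_left_mono) auto
  with 2 have "L \<le> 14 * real d * (ln K)\<^sup>2" by (simp add: power2_eq_square mult_ac)
  then show ?thesis by (simp add: L_def K_def p_def)
qed

section \<open>Rounding real-valued classes\<close>

text \<open>Clipping leaves \<open>65\<close> values whatever the range of \<open>f\<close>. For the
  step \<open>s = 2 ^ k * (t / 32)\<close> used below, the clipping height \<open>32 * s\<close> is
  \<open>2 ^ k * t\<close>.\<close>

definition level :: "('a \<Rightarrow> real) \<Rightarrow> real \<Rightarrow> ('a \<Rightarrow> real) \<Rightarrow> 'a \<Rightarrow> int" where
  "level f0 s f x = max (-32) (min 32 \<lfloor>(f x - f0 x) / s\<rfloor>)"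

text \<open>The threshold \<open>h x + 1\<close>, in units of \<open>s\<close>, works because
  clipping is invisible to a pattern: \<open>h x < 32\<close> makes \<open>level \<le> h x\<close> a
  true upper bound on the floor, and \<open>h x + 2 > -32\<close> makes
  \<open>h x + 2 \<le> level\<close> a true lower bound.\<close>

lemma shattered_of_pattern:
  assumes s: "0 < s" and "A \<subseteq> F" and pat: "(\<sigma>, h) \<in> patterns X {-32..32} (level f0 s ` A)"
  shows "shattered F s \<sigma>"
  unfolding shattered_def
proof (intro exI[of _ "\<lambda>x. f0 x + (real_of_int (h x) + 1) * s"] allI impI)
  fix \<sigma>m \<sigma>p assume part: "\<sigma>m \<union> \<sigma>p = \<sigma> \<and> \<sigma>m \<inter> \<sigma>p = {}"
  have split: "\<forall>\<tau>\<subseteq>\<sigma>. \<exists>f\<in>A. (\<forall>x\<in>\<sigma> - \<tau>. level f0 s f x \<le> h x) \<and> (\<forall>x\<in>\<tau>. h x + 2 \<le> level f0 s f x)"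
    and h: "\<And>x. x \<in> \<sigma> \<Longrightarrow> -32 \<le> h x"
    using pat by (auto simp: patterns_def PiE_iff)
  have h_less: "h x < 32" if "x \<in> \<sigma>" for x
  proof -
    from split obtain f where "\<forall>x\<in>\<sigma>. h x + 2 \<le> level f0 s f x" by blast
    with that have "h x + 2 \<le> level f0 s f x" by blast
    then show ?thesis by (simp add: level_def)
  qed
  from split part obtain f where f: "f \<in> A" "\<forall>x\<in>\<sigma> - \<sigma>p. level f0 s f x \<le> h x"
    "\<forall>x\<in>\<sigma>p. h x + 2 \<le> level f0 s f x" by blast
  show "\<exists>f\<in>F. (\<forall>x\<in>\<sigma>m. f x \<le> f0 x + (real_of_int (h x) + 1) * s) \<and>
      (\<forall>x\<in>\<sigma>p. f x \<ge> f0 x + (real_of_int (h x) + 1) * s + s)"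
  proof (intro bexI[of _ f] conjI ballI)
    show "f \<in> F" using f(1) assms(2) by blast
  next
    fix x assume "x \<in> \<sigma>m"
    then have x: "x \<in> \<sigma>" "x \<in> \<sigma> - \<sigma>p" using part by auto
    have "\<lfloor>(f x - f0 x) / s\<rfloor> \<le> h x"
      using f(2)[rule_format, OF x(2)] h_less[OF x(1)] by (auto simp: level_def min_def split: if_splits)
    then have "(f x - f0 x) / s \<le> real_of_int (h x) + 1" by linarith
    then show "f x \<le> f0 x + (real_of_int (h x) + 1) * s" using s by (simp add: pos_divide_le_eq)
  next
    fix x assume x: "x \<in> \<sigma>p"
    then have "x \<in> \<sigma>" using part by auto
    then have "h x + 2 \<le> \<lfloor>(f x - f0 x) / s\<rfloor>"
      using f(3) x h by (force simp: level_def)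
    then have "real_of_int (h x) + 2 \<le> (f x - f0 x) / s" by linarith
    then show "f x \<ge> f0 x + (real_of_int (h x) + 1) * s + s"
      using s by (simp add: pos_le_divide_eq algebra_simps)
  qed
qed

lemma card_le_comb_dim:
  assumes "finite \<sigma>" "\<sigma> \<subseteq> \<Omega>" "shattered F t \<sigma>"
  shows "enat (card \<sigma>) \<le> comb_dim \<Omega> F t"
  unfolding comb_dim_def
  using assms by (intro Sup_upper CollectI exI[of _ \<sigma>]) (simp add: ext_card_def)

text \<open>Two functions that are separated at one point already force dimension at least
  \<open>1\<close>, as \<open>ln_card_le_patterns_dim\<close> requires of \<open>d\<close>.\<close>

lemma singleton_pattern:
  assumes "f \<in> A" "g \<in> A" "x \<in> X" "f x \<in> V" "f x + 2 \<le> g x"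
  shows "({x}, (\<lambda>_. undefined)(x := f x)) \<in> patterns X V A"
proof -
  have "\<exists>k\<in>A. (\<forall>y\<in>{x} - \<tau>. k y \<le> ((\<lambda>_. undefined)(x := f x)) y)
      \<and> (\<forall>y\<in>\<tau>. ((\<lambda>_. undefined)(x := f x)) y + 2 \<le> k y)" if "\<tau> \<subseteq> {x}" for \<tau>
    using that assms by (cases "\<tau> = {}") (auto simp: subset_singleton_iff intro: bexI[of _ f] bexI[of _ g])
  moreover have "(\<lambda>_. undefined)(x := f x) \<in> {x} \<rightarrow>\<^sub>E V"
    using assms by (auto simp: PiE_iff extensional_def)
  ultimately show ?thesis using assms by (simp add: patterns_def)
qed

lemma ln_card_le_comb_dim:
  fixes w :: "'a \<Rightarrow> real" and A :: "('a \<Rightarrow> real) set" and \<beta> :: real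
  assumes fin: "finite X" "finite A" and sub: "X \<subseteq> \<Omega>" "A \<subseteq> F" and s: "0 < s"
    and w: "\<And>x. x \<in> X \<Longrightarrow> 0 \<le> w x" "sum w X = 1"
    and \<beta>: "0 < \<beta>" "\<beta> \<le> 1"
    and sep: "\<And>f g. f \<in> A \<Longrightarrow> g \<in> A \<Longrightarrow> f \<noteq> g \<Longrightarrow>
      \<beta> \<le> (\<Sum>x\<in>X. w x * of_bool (2 \<le> \<bar>level f0 s f x - level f0 s g x\<bar>))"
  shows "ennreal (ln (card A)) \<le>
    ennreal (14 * (ln (8 * 65\<^sup>2 / \<beta>))\<^sup>2) * ennreal_of_enat (comb_dim \<Omega> F s)"
proof (cases "comb_dim \<Omega> F s")
  case infinity
  \<comment> \<open>In \<open>ennreal\<close> the product \<open>0 * \<infinity>\<close> is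
    \<open>0\<close>, so the coefficient has to be shown positive.\<close>
  have "1 < 8 * 65\<^sup>2 / \<beta>" using \<beta> by (simp add: field_simps)
  then have "0 < (ln (8 * 65\<^sup>2 / \<beta>))\<^sup>2" by (intro zero_less_power ln_gt_zero)
  then show ?thesis using infinity by (simp add: ennreal_mult_top)
next
  case (enat d)
  let ?G = "level f0 s ` A" and ?V = "{-32..32 :: int}"
  have val: "level f0 s f x \<in> ?V" for f x by (auto simp: level_def)
  have inj: "inj_on (level f0 s) A"
  proof (rule inj_onI, rule ccontr)
    fix f g assume "f \<in> A" "g \<in> A" "level f0 s f = level f0 s g" "f \<noteq> g"
    with sep[of f g] \<beta> show False by simp
  qed
  have sep': "\<beta> \<le> (\<Sum>x\<in>X. w x * of_bool (2 \<le> \<bar>p x - q x\<bar>))" if "p \<in> ?G" "q \<in> ?G" "p \<noteq> q" for p q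
    using that sep by auto
  have pat: "card \<sigma> \<le> d" if "(\<sigma>, h) \<in> patterns X ?V ?G" for \<sigma> h
  proof -
    have "\<sigma> \<subseteq> X" using that by (auto simp: patterns_def)
    then have "enat (card \<sigma>) \<le> comb_dim \<Omega> F s"
      using fin sub shattered_of_pattern[OF s sub(2) that]
      by (intro card_le_comb_dim) (auto intro: finite_subset)
    then show ?thesis using enat by simp
  qed
  show ?thesis
  proof (cases "card ?G \<le> 1")
    case True
    then have "card A = 0 \<or> card A = 1" using inj by (auto simp: card_image)
    then show ?thesis by auto
  next
    case False
    then obtain p q where pq: "p \<in> ?G" "q \<in> ?G" "p \<noteq> q"
      using fin(2) by (metis card_le_Suc0_iff_eq finite_imageI One_nat_def)
    have "\<exists>x\<in>X. 2 \<le> \<bar>p x - q x\<bar>"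
    proof (rule ccontr)
      assume "\<not> ?thesis"
      then have "(\<Sum>x\<in>X. w x * of_bool (2 \<le> \<bar>p x - q x\<bar>)) = 0" by (intro sum.neutral) auto
      with sep'[OF pq] \<beta> show False by simp
    qed
    then obtain x where x: "x \<in> X" "p x + 2 \<le> q x \<or> q x + 2 \<le> p x" by fastforce
    have "p x \<in> ?V" "q x \<in> ?V" using pq val by auto
    with singleton_pattern[of p ?G q x X ?V] singleton_pattern[of q ?G p x X ?V] pq x
    have "\<exists>h. ({x}, h) \<in> patterns X ?V ?G" by blast
    then have d: "1 \<le> d" using pat by fastforce
    have "ln (card ?G) \<le> 14 * real d * (ln (8 * (real (card ?V))\<^sup>2 / \<beta>))\<^sup>2"
      by (rule ln_card_le_patterns_dim[of X ?V ?G w \<beta> d]) (use fin w \<beta> val sep' d pat in auto)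
    then have "ln (card A) \<le> 14 * (ln (8 * 65\<^sup>2 / \<beta>))\<^sup>2 * real d"
      using inj by (simp add: card_image mult_ac)
    then have "ennreal (ln (card A)) \<le> ennreal (14 * (ln (8 * 65\<^sup>2 / \<beta>))\<^sup>2 * real d)"
      by (rule ennreal_leI)
    also have "\<dots> = ennreal (14 * (ln (8 * 65\<^sup>2 / \<beta>))\<^sup>2) * ennreal_of_enat (comb_dim \<Omega> F s)"
      by (simp add: enat ennreal_mult ennreal_of_nat_eq_real_of_nat)
    finally show ?thesis .
  qed
qed

section \<open>Squared distances and separation at dyadic scales\<close>

definition sqdist :: "('a \<Rightarrow> real) \<Rightarrow> 'a set \<Rightarrow> ('a \<Rightarrow> real) \<Rightarrow> ('a \<Rightarrow> real) \<Rightarrow> real" where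
  "sqdist w X f g = (\<Sum>x\<in>X. w x * (f x - g x)\<^sup>2)"

lemma sqdist_commute: "sqdist w X f g = sqdist w X g f"
  by (simp add: sqdist_def power2_commute)

lemma sqdist_self [simp]: "sqdist w X f f = 0"
  by (simp add: sqdist_def)

text \<open>
  The scale \<open>k\<close> is the least one at which neither \<open>u\<close> nor \<open>v\<close> is clipped. Thus \<open>2\<^sup>k\<close> is comparable to
  \<open>max \<bar>u\<bar> \<bar>v\<bar>\<close> (or \<open>k = 0\<close>), so that a difference below \<open>3/32 * 2\<^sup>k\<close> only contributes a
  small multiple of \<open>1 + u\<^sup>2 + v\<^sup>2\<close>, without any loss from summing over the scales.
\<close>

lemma floor_level_separated:
  fixes u v :: real
  assumes "\<bar>u\<bar> \<le> 2 ^ n" "\<bar>v\<bar> \<le> 2 ^ n"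
  shows "(u - v)\<^sup>2 \<le> 9 / 1024 * (1 + 4 * (u\<^sup>2 + v\<^sup>2)) + (\<Sum>k\<le>n. 4 * 4 ^ k * of_bool
    (3 \<le> \<bar>max (-32) (min 32 \<lfloor>32 * u / 2 ^ k\<rfloor>) - max (-32) (min 32 \<lfloor>32 * v / 2 ^ k\<rfloor>)\<bar>))"
    (is "_ \<le> ?a + (\<Sum>k\<le>n. ?b k)")
proof -
  define k where "k = (LEAST k. \<bar>u\<bar> \<le> 2 ^ k \<and> \<bar>v\<bar> \<le> 2 ^ k)"
  have k: "\<bar>u\<bar> \<le> 2 ^ k" "\<bar>v\<bar> \<le> 2 ^ k"
    using LeastI[of "\<lambda>k. \<bar>u\<bar> \<le> 2 ^ k \<and> \<bar>v\<bar> \<le> 2 ^ k" n] assms by (auto simp: k_def)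
  have "k \<le> n" unfolding k_def using assms by (intro Least_le) auto
  have small: "4 ^ k \<le> 1 + 4 * (u\<^sup>2 + v\<^sup>2)"
  proof (cases k)
    case (Suc j)
    then have "\<not> (\<bar>u\<bar> \<le> 2 ^ j \<and> \<bar>v\<bar> \<le> 2 ^ j)"
      unfolding k_def by (intro not_less_Least) simp
    then have "(2 ^ j)\<^sup>2 \<le> \<bar>u\<bar>\<^sup>2 \<or> (2 ^ j)\<^sup>2 \<le> \<bar>v\<bar>\<^sup>2"
      by (meson less_imp_le not_le power_mono zero_le_numeral zero_le_power)
    moreover have "((2::real) ^ j)\<^sup>2 = 4 ^ j"
      by (simp add: power_mult[symmetric] mult.commute[of j] power_mult)
    ultimately have "4 ^ j \<le> u\<^sup>2 \<or> 4 ^ j \<le> v\<^sup>2" by simp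
    then have "4 ^ j \<le> u\<^sup>2 + v\<^sup>2" using zero_le_power2[of u] zero_le_power2[of v] by linarith
    then show ?thesis using Suc by simp
  qed simp
  have four: "((2::real) ^ k)\<^sup>2 = 4 ^ k"
    by (simp add: power_mult[symmetric] mult.commute[of k] power_mult)
  have b0: "0 \<le> ?b j" for j by simp
  show ?thesis
  proof (cases "3 * 2 ^ k / 32 \<le> \<bar>u - v\<bar>")
    case True
    have "-32 \<le> 32 * u / 2 ^ k" "32 * u / 2 ^ k \<le> 32" "-32 \<le> 32 * v / 2 ^ k" "32 * v / 2 ^ k \<le> 32"
      using k by (auto simp: field_simps abs_le_iff)
    then have clip: "max (-32) (min 32 \<lfloor>32 * u / 2 ^ k\<rfloor>) = \<lfloor>32 * u / 2 ^ k\<rfloor>"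
      "max (-32) (min 32 \<lfloor>32 * v / 2 ^ k\<rfloor>) = \<lfloor>32 * v / 2 ^ k\<rfloor>" by linarith+
    have "3 \<le> \<bar>32 * u / 2 ^ k - 32 * v / 2 ^ k\<bar>"
      using True by (simp add: field_simps abs_if split: if_splits)
    \<comment> \<open>Reals at distance at least \<open>3\<close> have floors at distance more than
      \<open>2\<close>, hence at least \<open>3\<close>.\<close>
    then have "3 \<le> \<bar>\<lfloor>32 * u / 2 ^ k\<rfloor> - \<lfloor>32 * v / 2 ^ k\<rfloor>\<bar>" by linarith
    then have "?b k = 4 * 4 ^ k" unfolding clip by simp
    moreover have "\<bar>u - v\<bar> \<le> 2 * 2 ^ k" using k by linarith
    then have "\<bar>u - v\<bar>\<^sup>2 \<le> (2 * 2 ^ k)\<^sup>2" by (intro power_mono) auto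
    then have "(u - v)\<^sup>2 \<le> 4 * 4 ^ k" by (simp add: power_mult_distrib four)
    moreover have "?b k \<le> (\<Sum>k\<le>n. ?b k)" using \<open>k \<le> n\<close> b0 by (intro member_le_sum) auto
    moreover have "0 \<le> ?a" by simp
    ultimately show ?thesis by linarith
  next
    case False
    then have "\<bar>u - v\<bar>\<^sup>2 \<le> (3 * 2 ^ k / 32)\<^sup>2" by (intro power_mono) auto
    also have "\<dots> = 9 / 1024 * 4 ^ k" by (simp add: power_mult_distrib power_divide four)
    also have "\<dots> \<le> ?a" using small by (intro mult_left_mono) auto
    finally have "(u - v)\<^sup>2 \<le> ?a" by (simp only: power2_abs)
    moreover have "0 \<le> (\<Sum>k\<le>n. ?b k)" by (intro sum_nonneg b0)
    ultimately show ?thesis by linarith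
  qed
qed

text \<open>Otherwise, integrating \<open>floor_level_separated\<close> would give
  \<open>1 \<le> 9/1024 + 9/32 + 1/4\<close>: the ball condition bounds the second moments by
  \<open>4\<close>, and \<open>8 ^ k\<close> in the probabilities outweighs the factor
  \<open>4 ^ k\<close>. The gap \<open>3\<close> leaves room for a triangle inequality with gap
  \<open>2\<close>.\<close>

lemma level_separated_at_some_scale:
  assumes fin: "finite X" and w: "\<And>x. x \<in> X \<Longrightarrow> 0 \<le> w x" "sum w X = 1" and t: "0 < t"
    and near: "sqdist w X f f0 \<le> 4 * t\<^sup>2" "sqdist w X g f0 \<le> 4 * t\<^sup>2" and sep: "t\<^sup>2 \<le> sqdist w X f g"
  shows "\<exists>k. 1 / (32 * 8 ^ k) \<le>
    (\<Sum>x\<in>X. w x * of_bool (3 \<le> \<bar>level f0 (2 ^ k * (t / 32)) f x - level f0 (2 ^ k * (t / 32)) g x\<bar>))"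
proof (rule ccontr)
  define I :: "nat \<Rightarrow> 'a \<Rightarrow> real" where "I = (\<lambda>k x. of_bool (3 \<le> \<bar>level f0 (2 ^ k * (t / 32)) f x - level f0 (2 ^ k * (t / 32)) g x\<bar>))"
  assume "\<not> ?thesis"
  then have few: "(\<Sum>x\<in>X. w x * I k x) \<le> 1 / (32 * 8 ^ k)" for k by (auto simp: I_def not_le less_imp_le)
  define u where "u = (\<lambda>x. (f x - f0 x) / t)"
  define v where "v = (\<lambda>x. (g x - f0 x) / t)"
  have lev: "level f0 (2 ^ k * (t / 32)) f x = max (-32) (min 32 \<lfloor>32 * u x / 2 ^ k\<rfloor>)"
    "level f0 (2 ^ k * (t / 32)) g x = max (-32) (min 32 \<lfloor>32 * v x / 2 ^ k\<rfloor>)" for k x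
    using t by (simp_all add: level_def u_def v_def field_simps)
  \<comment> \<open>On the finite set \<open>X\<close> all values are bounded, so finitely many
    scales suffice; the estimates below are uniform in \<open>n\<close>.\<close>
  obtain n where n: "(\<Sum>x\<in>X. \<bar>u x\<bar> + \<bar>v x\<bar>) < 2 ^ n"
    using real_arch_pow[of 2 "\<Sum>x\<in>X. \<bar>u x\<bar> + \<bar>v x\<bar>"] by auto
  have uv: "\<bar>u x\<bar> \<le> 2 ^ n" "\<bar>v x\<bar> \<le> 2 ^ n" if "x \<in> X" for x
    using n member_le_sum[OF that, of "\<lambda>x. \<bar>u x\<bar> + \<bar>v x\<bar>"] fin by auto
  have sq: "(\<Sum>x\<in>X. w x * (u x)\<^sup>2) = sqdist w X f f0 / t\<^sup>2" "(\<Sum>x\<in>X. w x * (v x)\<^sup>2) = sqdist w X g f0 / t\<^sup>2"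
    by (simp_all add: sqdist_def u_def v_def power_divide sum_divide_distrib)
  have "u x - v x = (f x - g x) / t" for x by (simp add: u_def v_def diff_divide_distrib)
  then have suv: "(\<Sum>x\<in>X. w x * (u x - v x)\<^sup>2) = sqdist w X f g / t\<^sup>2"
    by (simp add: sqdist_def power_divide sum_divide_distrib)
  have "1 \<le> (\<Sum>x\<in>X. w x * (u x - v x)\<^sup>2)" unfolding suv using sep t by simp
  also have "\<dots> \<le> (\<Sum>x\<in>X. w x * (9 / 1024 * (1 + 4 * ((u x)\<^sup>2 + (v x)\<^sup>2)) + (\<Sum>k\<le>n. 4 * 4 ^ k * I k x)))"
    unfolding I_def lev using floor_level_separated[OF uv] w by (intro sum_mono mult_left_mono) auto
  also have "\<dots> = (\<Sum>x\<in>X. 9 / 1024 * w x + 9 / 256 * (w x * (u x)\<^sup>2) + 9 / 256 * (w x * (v x)\<^sup>2)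
      + (\<Sum>k\<le>n. 4 * 4 ^ k * (w x * I k x)))"
    by (intro sum.cong refl) (simp add: distrib_left sum_distrib_left mult_ac)
  also have "\<dots> = 9 / 1024 * sum w X + 9 / 256 * (\<Sum>x\<in>X. w x * (u x)\<^sup>2)
      + 9 / 256 * (\<Sum>x\<in>X. w x * (v x)\<^sup>2) + (\<Sum>x\<in>X. \<Sum>k\<le>n. 4 * 4 ^ k * (w x * I k x))"
    by (simp only: sum.distrib sum_distrib_left)
  also have "(\<Sum>x\<in>X. \<Sum>k\<le>n. 4 * 4 ^ k * (w x * I k x)) = (\<Sum>k\<le>n. 4 * 4 ^ k * (\<Sum>x\<in>X. w x * I k x))"
    by (subst sum.swap) (simp only: sum_distrib_left)
  also have "\<dots> \<le> (\<Sum>k\<le>n. 4 * 4 ^ k * (1 / (32 * 8 ^ k)))"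
    using few by (intro sum_mono mult_left_mono) auto
  also have "\<dots> = (\<Sum>k\<le>n. 1 / 8 * (1 / 2) ^ k)"
  proof (intro sum.cong refl)
    fix k :: nat
    have "(8::real) ^ k = 4 ^ k * 2 ^ k" by (simp flip: power_mult_distrib)
    then show "4 * 4 ^ k * (1 / (32 * 8 ^ k)) = 1 / 8 * (1 / 2 :: real) ^ k"
      by (simp add: power_one_over)
  qed
  also have "\<dots> \<le> 1 / 4"
    unfolding sum_distrib_left[symmetric] atMost_atLeast0 sum_gp by (simp add: field_simps)
  finally have "1 \<le> 9 / 1024 * sum w X + 9 / 256 * (\<Sum>x\<in>X. w x * (u x)\<^sup>2)
      + 9 / 256 * (\<Sum>x\<in>X. w x * (v x)\<^sup>2) + 1 / 4" by simp
  moreover have "(\<Sum>x\<in>X. w x * (u x)\<^sup>2) \<le> 4" "(\<Sum>x\<in>X. w x * (v x)\<^sup>2) \<le> 4"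
    unfolding sq using near t by (simp_all add: field_simps)
  ultimately show False using w(2) by linarith
qed

section \<open>Upper bound for the entropy\<close>

lemma sqrt_ennreal_square [simp]: "(sqrt_ennreal x)\<^sup>2 = x"
proof (cases x)
  case (real r)
  then show ?thesis by (simp add: sqrt_ennreal_def ennreal_power)
next
  case top
  then show ?thesis by (simp add: sqrt_ennreal_def power2_eq_square ennreal_mult_eq_top_iff)
qed

lemma sqrt_ennreal_le:
  assumes "x \<le> y\<^sup>2"
  shows "sqrt_ennreal x \<le> y"
proof (cases y)
  case (real b)
  then obtain a where a: "x = ennreal a" "0 \<le> a"
    using assms by (cases x) (auto simp: ennreal_power top_unique)
  then have "a \<le> b\<^sup>2" using assms real by (simp add: ennreal_power)
  then have "sqrt a \<le> b" using real by (simp add: real_le_lsqrt)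
  then show ?thesis using a real by (simp add: sqrt_ennreal_def ennreal_leI)
qed simp

lemma sqrt_ennreal_mono: "x \<le> y \<Longrightarrow> sqrt_ennreal x \<le> sqrt_ennreal y"
  by (rule sqrt_ennreal_le) simp

text \<open>Equivalently, the square root is subadditive, here for infinite series.\<close>

lemma suminf_square_le:
  fixes y :: "nat \<Rightarrow> ennreal"
  shows "(\<Sum>i. (y i)\<^sup>2) \<le> (\<Sum>i. y i)\<^sup>2"
proof -
  have "y i \<le> (\<Sum>i. y i)" for i
    using sum_le_suminf[of y "{i}"] by (simp add: summableI)
  then have "(\<Sum>i. (y i)\<^sup>2) \<le> (\<Sum>i. y i * (\<Sum>i. y i))"
    by (intro suminf_le) (auto simp: summableI power2_eq_square intro: mult_left_mono)
  then show ?thesis by (simp add: power2_eq_square)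
qed

definition dim_root :: "'a set \<Rightarrow> ('a \<Rightarrow> real) set \<Rightarrow> real \<Rightarrow> ennreal" where
  "dim_root \<Omega> F t = sqrt_ennreal (ennreal_of_enat (comb_dim \<Omega> F t))"

text \<open>\<open>2 ^ k * (t / 32)\<close> is the rounding step at scale \<open>k\<close>. The
  weight dominates the square root of the coefficient in \<open>ln_card_le_comb_dim\<close> for
  separation probability \<open>1 / (64 * 8 ^ k)\<close>, so it grows only linearly in
  \<open>k\<close>.\<close>

definition local_bound :: "'a set \<Rightarrow> ('a \<Rightarrow> real) set \<Rightarrow> real \<Rightarrow> ennreal" where
  "local_bound \<Omega> F t = (\<Sum>k. ennreal (60 * real (Suc k)) * dim_root \<Omega> F (2 ^ k * (t / 32)))"

text \<open>The argument of the logarithm is at most \<open>2 ^ (22 + 3 * k)\<close>. With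
  \<open>ln 2 \<le> 8/11\<close> the logarithm is at most \<open>16 * (k + 1)\<close>, and
  \<open>14 * 16^2 = 3584\<close> is below \<open>60^2\<close>.\<close>

lemma log_constant_bound:
  "14 * (ln (8 * 65\<^sup>2 / (1 / (64 * 8 ^ k))))\<^sup>2 \<le> (60 * real (Suc k))\<^sup>2"
proof -
  have ln2: "ln (2::real) \<le> 8 / 11"
    using ln2_le_25_over_36 by simp
  have "ln (8 * 65\<^sup>2 / (1 / (64 * 8 ^ k)) :: real) \<le> ln (2 ^ (22 + 3 * k))"
    by (subst ln_le_cancel_iff) (auto simp: power_add power_mult)
  also have "\<dots> = real (22 + 3 * k) * ln 2" by (simp only: ln_realpow zero_less_numeral)
  also have "\<dots> \<le> real (22 + 3 * k) * (8 / 11)" using ln2 by (intro mult_left_mono) auto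
  also have "\<dots> \<le> 16 * real (Suc k)" by simp
  finally have "ln (8 * 65\<^sup>2 / (1 / (64 * 8 ^ k)) :: real) \<le> 16 * real (Suc k)" .
  moreover have "1 \<le> (8 * 65\<^sup>2 / (1 / (64 * 8 ^ k)) :: real)"
  proof -
    have "1 * 1 \<le> 2163200 * (8::real) ^ k" by (intro mult_mono) auto
    then show ?thesis by simp
  qed
  then have "0 \<le> ln (8 * 65\<^sup>2 / (1 / (64 * 8 ^ k)) :: real)" by (rule ln_ge_zero)
  ultimately have "(ln (8 * 65\<^sup>2 / (1 / (64 * 8 ^ k)) :: real))\<^sup>2 \<le> (16 * real (Suc k))\<^sup>2"
    by (intro power_mono)
  moreover have "(16 * real (Suc k))\<^sup>2 = 256 * (real (Suc k))\<^sup>2" "(60 * real (Suc k))\<^sup>2 = 3600 * (real (Suc k))\<^sup>2"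
    by (simp_all add: power_mult_distrib del: of_nat_Suc)
  ultimately show ?thesis using zero_le_power2[of "real (Suc k)"] by linarith
qed

text \<open>
  In an \<open>L\<^sub>2\<close> ball of radius \<open>2t\<close>, every two \<open>t\<close>-separated functions are separated at one of the scales;
  a function is determined by its nearest elements in maximal separated subsets at all scales.
\<close>

lemma local_entropy:
  assumes fin: "finite X" "finite A" and sub: "X \<subseteq> \<Omega>" "A \<subseteq> F" and t: "0 < t"
    and w: "\<And>x. x \<in> X \<Longrightarrow> 0 \<le> w x" "sum w X = 1"
    and near: "\<And>f. f \<in> A \<Longrightarrow> sqdist w X f f0 \<le> 4 * t\<^sup>2"
    and sep: "\<And>f g. f \<in> A \<Longrightarrow> g \<in> A \<Longrightarrow> f \<noteq> g \<Longrightarrow> t\<^sup>2 \<le> sqdist w X f g"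
  shows "ennreal (ln (card A)) \<le> (local_bound \<Omega> F t)\<^sup>2"
proof (cases "A = {}")
  case False
  define s where "s = (\<lambda>k::nat. 2 ^ k * (t / 32))"
  define D where "D = (\<lambda>k c f g. (\<Sum>x\<in>X. w x * of_bool (c \<le> \<bar>level f0 (s k) f x - level f0 (s k) g x\<bar>)))"
  define R where "R = (\<lambda>k f g. 1 / (64 * 8 ^ k) \<le> D k 2 f g)"
  have s0: "0 < s k" for k using t by (simp add: s_def)
  have D_commute: "D k c f g = D k c g f" for k c f g by (simp add: D_def abs_minus_commute)
  \<comment> \<open>If two integers are both at distance at most \<open>1\<close> from a third, they
    are at distance at most \<open>2\<close> from each other.\<close>
  have D_triangle: "D k 3 f g \<le> D k 2 f b + D k 2 g b" for k f g b
    unfolding D_def sum.distrib[symmetric]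
  proof (intro sum_mono)
    fix x assume "x \<in> X"
    have "(of_bool (3 \<le> \<bar>level f0 (s k) f x - level f0 (s k) g x\<bar>) :: real)
        \<le> of_bool (2 \<le> \<bar>level f0 (s k) f x - level f0 (s k) b x\<bar>)
          + of_bool (2 \<le> \<bar>level f0 (s k) g x - level f0 (s k) b x\<bar>)"
      by (auto simp: of_bool_def)
    from mult_left_mono[OF this w(1)[OF \<open>x \<in> X\<close>]]
    show "w x * of_bool (3 \<le> \<bar>level f0 (s k) f x - level f0 (s k) g x\<bar>)
        \<le> w x * of_bool (2 \<le> \<bar>level f0 (s k) f x - level f0 (s k) b x\<bar>)
          + w x * of_bool (2 \<le> \<bar>level f0 (s k) g x - level f0 (s k) b x\<bar>)"
      by (simp only: distrib_left)
  qed
  have R_commute: "R k g f" if "R k f g" for k f g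
    using that unfolding R_def by (subst D_commute)
  have R_irrefl: "\<not> R k f f" for k f
    by (simp add: R_def D_def not_le)
  have "\<forall>k. \<exists>B\<subseteq>A. (\<forall>f\<in>B. \<forall>g\<in>B. f \<noteq> g \<longrightarrow> R k f g) \<and> (\<forall>f\<in>A. \<exists>b\<in>B. \<not> R k f b)"
  proof
    show "\<exists>B\<subseteq>A. (\<forall>f\<in>B. \<forall>g\<in>B. f \<noteq> g \<longrightarrow> R k f g) \<and> (\<forall>f\<in>A. \<exists>b\<in>B. \<not> R k f b)" for k
      by (rule maximal_separated[OF fin(2)]) (rule R_commute, assumption, rule R_irrefl)
  qed
  then obtain B where B_all: "\<forall>k. B k \<subseteq> A \<and> (\<forall>f\<in>B k. \<forall>g\<in>B k. f \<noteq> g \<longrightarrow> R k f g)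
      \<and> (\<forall>f\<in>A. \<exists>b\<in>B k. \<not> R k f b)" by (rule choice[THEN exE])
  then have B1: "B k \<subseteq> A" and B2: "f \<in> B k \<Longrightarrow> g \<in> B k \<Longrightarrow> f \<noteq> g \<Longrightarrow> R k f g"
    and B3: "f \<in> A \<Longrightarrow> \<exists>b\<in>B k. \<not> R k f b" for k f g by auto
  define \<pi> where "\<pi> = (\<lambda>k f. SOME b. b \<in> B k \<and> \<not> R k f b)"
  have "\<pi> k f \<in> B k \<and> \<not> R k f (\<pi> k f)" if f: "f \<in> A" for k f
  proof -
    obtain b where "b \<in> B k \<and> \<not> R k f b" using B3[OF f] by blast
    then show ?thesis unfolding \<pi>_def by (rule someI[of "\<lambda>b. b \<in> B k \<and> \<not> R k f b"])
  qed
  then have \<pi>: "\<And>k f. f \<in> A \<Longrightarrow> \<pi> k f \<in> B k" "\<And>k f. f \<in> A \<Longrightarrow> \<not> R k f (\<pi> k f)" by blast+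
  have finB: "finite (B k)" for k using B1 fin(2) finite_subset by blast
  have Bne: "B k \<noteq> {}" for k using B3 False by blast
  have scale: "\<exists>k. 1 / (32 * 8 ^ k) \<le> D k 3 f g" if "f \<in> A" "g \<in> A" "f \<noteq> g" for f g
    unfolding D_def s_def
    by (rule level_separated_at_some_scale[OF fin(1) w t near near sep]) (use that in auto)
  define \<kappa> where "\<kappa> = (\<lambda>f g. SOME k. 1 / (32 * 8 ^ k) \<le> D k 3 f g)"
  have \<kappa>: "1 / (32 * 8 ^ \<kappa> f g) \<le> D (\<kappa> f g) 3 f g" if fg: "f \<in> A" "g \<in> A" "f \<noteq> g" for f g
  proof -
    obtain k where "1 / (32 * 8 ^ k) \<le> D k 3 f g" using scale[OF fg] by blast
    then show ?thesis unfolding \<kappa>_def by (rule someI[of "\<lambda>k. 1 / (32 * 8 ^ k) \<le> D k 3 f g"])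
  qed
  \<comment> \<open>Only finitely many pairs occur, so finitely many scales suffice and the product
    of the nets is finite.\<close>
  obtain n where n: "\<And>f g. f \<in> A \<Longrightarrow> g \<in> A \<Longrightarrow> \<kappa> f g < n"
  proof -
    have "finite ((\<lambda>(f, g). \<kappa> f g) ` (A \<times> A))" using fin by simp
    then obtain n where "\<forall>k\<in>(\<lambda>(f, g). \<kappa> f g) ` (A \<times> A). k < n"
      using finite_nat_set_iff_bounded by blast
    then show ?thesis using that by fastforce
  qed
  define \<Phi> where "\<Phi> = (\<lambda>f. \<lambda>k\<in>{..<n}. \<pi> k f)"
  have "inj_on \<Phi> A"
  proof (rule inj_onI, rule ccontr)
    fix f g assume fg: "f \<in> A" "g \<in> A" "\<Phi> f = \<Phi> g" "f \<noteq> g"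
    \<comment> \<open>Functions with the same net point at scale \<open>?k\<close> differ by
      \<open>3\<close> with probability below \<open>1 / (32 * 8 ^ ?k)\<close>, against the choice
      of \<open>?k\<close>.\<close>
    let ?k = "\<kappa> f g"
    have "\<pi> ?k f = \<pi> ?k g"
      using fun_cong[OF fg(3), of ?k] n[OF fg(1,2)] by (simp add: \<Phi>_def)
    then have "D ?k 3 f g < 1 / (64 * 8 ^ ?k) + 1 / (64 * 8 ^ ?k)"
      using D_triangle[of ?k f g "\<pi> ?k f"] \<pi>(2)[OF fg(1), of ?k] \<pi>(2)[OF fg(2), of ?k]
      by (simp add: R_def not_le)
    also have "\<dots> = 1 / (32 * 8 ^ ?k)" by simp
    finally show False using \<kappa>[OF fg(1,2,4)] by simp
  qed
  then have "card A = card (\<Phi> ` A)" by (simp add: card_image)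
  also have "\<dots> \<le> card (PiE {..<n} B)"
    using finB \<pi>(1) by (intro card_mono finite_PiE) (auto simp: \<Phi>_def)
  also have "\<dots> = (\<Prod>k<n. card (B k))" by (simp add: card_PiE)
  finally have le: "card A \<le> (\<Prod>k<n. card (B k))" .
  have "real (card A) \<le> (\<Prod>k<n. real (card (B k)))"
    using of_nat_mono[OF le, where 'a=real] by simp
  then have "ln (card A) \<le> ln (\<Prod>k<n. real (card (B k)))"
    using False fin by (subst ln_le_cancel_iff) (auto simp: card_gt_0_iff Bne finB intro!: prod_pos)
  also have "\<dots> = (\<Sum>k<n. ln (real (card (B k))))"
    using Bne finB by (intro ln_prod) auto
  finally have "ennreal (ln (card A)) \<le> ennreal (\<Sum>k<n. ln (real (card (B k))))" by (rule ennreal_leI)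
  also have "\<dots> = (\<Sum>k<n. ennreal (ln (real (card (B k)))))"
    using Bne finB by (intro sum_ennreal[symmetric] ln_ge_zero) (simp add: Suc_le_eq card_gt_0_iff)
  also have "\<dots> \<le> (\<Sum>k<n. (ennreal (60 * real (Suc k)) * dim_root \<Omega> F (s k))\<^sup>2)"
  proof (intro sum_mono)
    fix k
    have "1 * 1 \<le> 64 * (8::real) ^ k" by (intro mult_mono) auto
    then have \<beta>: "0 < 1 / (64 * 8 ^ k :: real)" "1 / (64 * 8 ^ k :: real) \<le> 1" by auto
    have BF: "B k \<subseteq> F" using B1 sub(2) by blast
    have "ennreal (ln (card (B k)))
        \<le> ennreal (14 * (ln (8 * 65\<^sup>2 / (1 / (64 * 8 ^ k))))\<^sup>2) * ennreal_of_enat (comb_dim \<Omega> F (s k))"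
      by (rule ln_card_le_comb_dim[of X "B k" \<Omega> F "s k" w "1 / (64 * 8 ^ k)" f0])
        (use fin finB sub BF B2 w s0 \<beta> in \<open>auto simp: R_def D_def\<close>)
    also have "\<dots> \<le> ennreal ((60 * real (Suc k))\<^sup>2) * ennreal_of_enat (comb_dim \<Omega> F (s k))"
      by (intro mult_right_mono ennreal_leI log_constant_bound) simp
    also have "\<dots> = (ennreal (60 * real (Suc k)) * dim_root \<Omega> F (s k))\<^sup>2"
    proof -
      have "(ennreal (60 * real (Suc k)))\<^sup>2 = ennreal ((60 * real (Suc k))\<^sup>2)" by (rule ennreal_power) simp
      then show ?thesis
        by (simp only: power_mult_distrib[of "ennreal (60 * real (Suc k))"] dim_root_def sqrt_ennreal_square)
    qed
    finally show "ennreal (ln (card (B k))) \<le> (ennreal (60 * real (Suc k)) * dim_root \<Omega> F (s k))\<^sup>2" .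
  qed
  also have "\<dots> \<le> (\<Sum>k. (ennreal (60 * real (Suc k)) * dim_root \<Omega> F (s k))\<^sup>2)"
    by (intro sum_le_suminf) (auto simp: summableI)
  also have "\<dots> \<le> (local_bound \<Omega> F t)\<^sup>2"
    unfolding local_bound_def s_def by (rule suminf_square_le)
  finally show ?thesis .
qed simp

text \<open>A maximal \<open>2 * t\<close>-separated subset \<open>B\<close> covers \<open>A\<close>
  by balls of radius \<open>2 * t\<close>, so \<open>card A\<close> is at most \<open>card B\<close>
  times the size of one ball. The ball is handled by \<open>local_entropy\<close>. Relative to its
  separation, \<open>B\<close> has half the diameter bound of \<open>A\<close>, so the induction on
  \<open>j\<close> applies to it.\<close>

lemma chained_entropy:
  assumes fin: "finite X" "finite A" and sub: "X \<subseteq> \<Omega>" "A \<subseteq> F" and t: "0 < t"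
    and w: "\<And>x. x \<in> X \<Longrightarrow> 0 \<le> w x" "sum w X = 1"
    and sep: "\<And>f g. f \<in> A \<Longrightarrow> g \<in> A \<Longrightarrow> f \<noteq> g \<Longrightarrow> t\<^sup>2 \<le> sqdist w X f g"
    and diam: "\<And>f g. f \<in> A \<Longrightarrow> g \<in> A \<Longrightarrow> sqdist w X f g < (2 ^ j * t)\<^sup>2"
  shows "ennreal (ln (card A)) \<le> (\<Sum>i<j. (local_bound \<Omega> F (2 ^ i * t))\<^sup>2)"
  using fin(2) sub(2) t sep diam
proof (induction j arbitrary: A t)
  case 0
  \<comment> \<open>For \<open>j = 0\<close> the distances are both below \<open>t\<close> and,
    between distinct functions, at least \<open>t\<close>.\<close>
  have "f = g" if "f \<in> A" "g \<in> A" for f g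
    using 0(4)[OF that] 0(5)[OF that] by fastforce
  then have "card A \<le> 1" using 0(1) by (metis card_le_Suc0_iff_eq One_nat_def)
  then have "card A = 0 \<or> card A = 1" by auto
  then show ?case by auto
next
  case (Suc j)
  show ?case
  proof (cases "A = {}")
    case False
    define R where "R = (\<lambda>f g. (2 * t)\<^sup>2 \<le> sqdist w X f g)"
    have "\<exists>B\<subseteq>A. (\<forall>f\<in>B. \<forall>g\<in>B. f \<noteq> g \<longrightarrow> R f g) \<and> (\<forall>f\<in>A. \<exists>b\<in>B. \<not> R f b)"
      by (rule maximal_separated) (use Suc.prems(1,3) in \<open>auto simp: R_def sqdist_commute\<close>)
    then obtain B where B: "B \<subseteq> A" "\<forall>f\<in>B. \<forall>g\<in>B. f \<noteq> g \<longrightarrow> R f g"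
      "\<forall>f\<in>A. \<exists>b\<in>B. \<not> R f b" by blast
    obtain b where b: "b \<in> B" "card A \<le> card B * card {f\<in>A. \<not> R f b}"
      using card_le_largest_cluster[OF Suc.prems(1) False B(1,3)] by blast
    let ?C = "{f\<in>A. \<not> R f b}"
    have finB: "finite B" using B(1) Suc.prems(1) finite_subset by blast
    have "b \<in> ?C" using b(1) B(1) Suc.prems(3) by (auto simp: R_def)
    then have pos: "1 \<le> card B" "1 \<le> card ?C" "0 < card A"
      using b(1) finB Suc.prems(1) False by (auto simp: Suc_le_eq card_gt_0_iff)
    have IH: "ennreal (ln (card B)) \<le> (\<Sum>i<j. (local_bound \<Omega> F (2 ^ i * (2 * t)))\<^sup>2)"
    proof (rule Suc.IH)
      show "finite B" "B \<subseteq> F" "0 < 2 * t" using finB B(1) Suc.prems by auto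
      show "(2 * t)\<^sup>2 \<le> sqdist w X f g" if "f \<in> B" "g \<in> B" "f \<noteq> g" for f g
        using B(2) that by (auto simp: R_def)
      show "sqdist w X f g < (2 ^ j * (2 * t))\<^sup>2" if "f \<in> B" "g \<in> B" for f g
        using Suc.prems(5)[of f g] that B(1) by (auto simp: mult_ac)
    qed
    have C: "ennreal (ln (card ?C)) \<le> (local_bound \<Omega> F t)\<^sup>2"
      by (rule local_entropy[of X ?C \<Omega> F t w b])
        (use fin(1) sub(1) w Suc.prems in \<open>auto simp: R_def power_mult_distrib\<close>)
    have "ln (card A) \<le> ln (real (card B) * real (card ?C))"
      using pos of_nat_mono[OF b(2), where 'a=real] by (subst ln_le_cancel_iff) auto
    also have "\<dots> = ln (card B) + ln (card ?C)" using pos by (intro ln_mult_pos) auto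
    finally have "ennreal (ln (card A)) \<le> ennreal (ln (card B) + ln (card ?C))" by (rule ennreal_leI)
    also have "\<dots> = ennreal (ln (card B)) + ennreal (ln (card ?C))"
      using pos by (intro ennreal_plus ln_ge_zero) auto
    also have "\<dots> \<le> (\<Sum>i<j. (local_bound \<Omega> F (2 ^ i * (2 * t)))\<^sup>2) + (local_bound \<Omega> F t)\<^sup>2"
      by (intro add_mono IH C)
    also have "\<dots> = (\<Sum>i<Suc j. (local_bound \<Omega> F (2 ^ i * t))\<^sup>2)"
      by (simp add: sum.lessThan_Suc_shift mult_ac del: sum.lessThan_Suc)
    finally show ?thesis .
  qed simp
qed

section \<open>From finite packings to the entropy\<close>

text \<open>A finite supremum of natural numbers is attained, and an infinite one makes the
  logarithms unbounded, so that \<open>B\<close> is infinite.\<close>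

lemma log_enat_Sup_le:
  assumes "\<And>n. P n \<Longrightarrow> ennreal (ln (real n)) \<le> B"
  shows "log_enat (Sup {enat n | n. P n}) \<le> B"
proof (cases "Sup {enat n | n. P n}")
  case (enat k)
  show ?thesis
  proof (cases "{enat n | n. P n} = {}")
    case True
    \<comment> \<open>The empty supremum is \<open>0\<close>, where the default value
      \<open>ln 0 = 0\<close> applies.\<close>
    then have "log_enat (Sup {enat n | n. P n}) = 0" by (simp add: log_enat_def bot_enat_def zero_enat_def)
    then show ?thesis by simp
  next
    case False
    have fin: "finite {enat n | n. P n}"
      using enat False by (auto simp: Sup_enat_def split: if_splits)
    have "Sup {enat n | n. P n} = Max {enat n | n. P n}"
      unfolding Sup_enat_def by (subst if_not_P[OF False], subst if_P[OF fin], rule refl)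
    with enat Max_in[OF fin False] have "enat k \<in> {enat n | n. P n}" by (simp only:)
    then have "P k" by auto
    then show ?thesis using assms enat by (simp add: log_enat_def)
  qed
next
  case infinity
  have "B = \<infinity>"
  proof (rule ccontr)
    assume "B \<noteq> \<infinity>"
    then obtain b where b: "B = ennreal b" "0 \<le> b" by (cases B) auto
    obtain N where N: "exp (b + 1) < real N" using reals_Archimedean2 by blast
    have "enat N < Sup {enat n | n. P n}" using infinity by simp
    then obtain n where n: "P n" "N < n" by (auto simp: less_Sup_iff)
    have N0: "0 < real N" using N exp_gt_zero[of "b + 1"] by linarith
    have "b + 1 < ln (real N)" using N N0 by (metis exp_less_cancel_iff exp_ln)
    also have "\<dots> \<le> ln (real n)" using n(2) N0 by simp
    finally have "b < ln (real n)" by simp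
    moreover have "ln (real n) \<le> b" using assms[OF n(1)] b by (simp add: ennreal_le_iff)
    ultimately show False by simp
  qed
  then show ?thesis by simp
qed

lemma packing_entropy_le:
  assumes t: "0 < t"
  shows "sqrt_ennreal (KP_entropy \<Omega> F t) \<le> (\<Sum>i. local_bound \<Omega> F (2 ^ i * t))"
proof (rule sqrt_ennreal_le)
  show "KP_entropy \<Omega> F t \<le> (\<Sum>i. local_bound \<Omega> F (2 ^ i * t))\<^sup>2"
    unfolding KP_entropy_def packing_number_def
  proof (rule log_enat_Sup_le, elim exE conjE)
    fix n :: nat and \<mu> :: "'a pmf" and f :: "nat \<Rightarrow> 'a \<Rightarrow> real"
    assume fin: "finite (set_pmf \<mu>)" and sub: "set_pmf \<mu> \<subseteq> \<Omega>" and F: "\<forall>i<n. f i \<in> F"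
      and sep: "\<forall>i j. i < j \<and> j < n \<longrightarrow> t\<^sup>2 \<le> measure_pmf.expectation \<mu> (\<lambda>x. (f i x - f j x)\<^sup>2)"
    let ?w = "pmf \<mu>" and ?X = "set_pmf \<mu>"
    have E: "measure_pmf.expectation \<mu> (\<lambda>x. (g x - h x)\<^sup>2) = sqdist ?w ?X g h" for g h
      using fin by (subst integral_measure_pmf[of ?X]) (auto simp: sqdist_def)
    have sep': "t\<^sup>2 \<le> sqdist ?w ?X (f i) (f j)" if "i < n" "j < n" "i \<noteq> j" for i j
      using sep[rule_format, of i j] sep[rule_format, of j i] that
      by (cases "i < j") (auto simp: E sqdist_commute)
    let ?A = "f ` {..<n}"
    have "inj_on f {..<n}"
    proof (rule inj_onI, rule ccontr)
      fix i j assume "i \<in> {..<n}" "j \<in> {..<n}" "f i = f j" "i \<noteq> j"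
      with sep'[of i j] t show False by simp
    qed
    then have card: "card ?A = n" by (simp add: card_image)
    \<comment> \<open>The sum of all squared distances dominates each of them. The size of
      \<open>j\<close> is irrelevant, since the final bound is the series over all scales.\<close>
    obtain j where j: "(\<Sum>g\<in>?A. \<Sum>h\<in>?A. sqdist ?w ?X g h) / t\<^sup>2 < 2 ^ j"
      using real_arch_pow[of 2 "(\<Sum>g\<in>?A. \<Sum>h\<in>?A. sqdist ?w ?X g h) / t\<^sup>2"] by auto
    have nonneg: "0 \<le> sqdist ?w ?X g h" for g h by (auto simp: sqdist_def intro!: sum_nonneg)
    have diam: "sqdist ?w ?X g h < (2 ^ j * t)\<^sup>2" if "g \<in> ?A" "h \<in> ?A" for g h
    proof -
      have "sqdist ?w ?X g h \<le> (\<Sum>h\<in>?A. sqdist ?w ?X g h)"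
        using that nonneg by (intro member_le_sum) auto
      also have "\<dots> \<le> (\<Sum>g\<in>?A. \<Sum>h\<in>?A. sqdist ?w ?X g h)"
        using that nonneg by (intro member_le_sum[of g ?A "\<lambda>g. \<Sum>h\<in>?A. sqdist ?w ?X g h"]) (auto intro!: sum_nonneg)
      also have "\<dots> < 2 ^ j * t\<^sup>2" using j t by (simp add: divide_less_eq)
      also have "\<dots> \<le> (2 ^ j)\<^sup>2 * t\<^sup>2"
        using self_le_power[of "2 ^ j :: real" 2] by (intro mult_right_mono) auto
      finally show ?thesis by (simp add: power_mult_distrib)
    qed
    have "ennreal (ln (card ?A)) \<le> (\<Sum>i<j. (local_bound \<Omega> F (2 ^ i * t))\<^sup>2)"
      by (rule chained_entropy[of ?X ?A \<Omega> F t ?w j])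
        (use fin sub F t sep' diam in \<open>auto simp: sum_pmf_eq_1\<close>)
    also have "\<dots> \<le> (\<Sum>i. (local_bound \<Omega> F (2 ^ i * t))\<^sup>2)"
      by (intro sum_le_suminf) (auto simp: summableI)
    also have "\<dots> \<le> (\<Sum>i. local_bound \<Omega> F (2 ^ i * t))\<^sup>2" by (rule suminf_square_le)
    finally show "ennreal (ln (real n)) \<le> (\<Sum>i. local_bound \<Omega> F (2 ^ i * t))\<^sup>2" by (simp add: card)
  qed
qed

section \<open>Lower bound for the entropy\<close>

lemma shattered_subset:
  assumes "shattered F t \<sigma>" "\<tau> \<subseteq> \<sigma>"
  shows "shattered F t \<tau>"
proof -
  from assms(1) obtain h where h: "\<forall>\<sigma>m \<sigma>p. \<sigma>m \<union> \<sigma>p = \<sigma> \<and> \<sigma>m \<inter> \<sigma>p = {} \<longrightarrow>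
      (\<exists>f\<in>F. (\<forall>x\<in>\<sigma>m. f x \<le> h x) \<and> (\<forall>x\<in>\<sigma>p. f x \<ge> h x + t))"
    unfolding shattered_def by blast
  show ?thesis
    unfolding shattered_def
  proof (intro exI[of _ h] allI impI)
    fix \<tau>m \<tau>p assume part: "\<tau>m \<union> \<tau>p = \<tau> \<and> \<tau>m \<inter> \<tau>p = {}"
    then have "\<exists>f\<in>F. (\<forall>x\<in>\<tau>m \<union> (\<sigma> - \<tau>). f x \<le> h x) \<and> (\<forall>x\<in>\<tau>p. f x \<ge> h x + t)"
      using h[rule_format, of "\<tau>m \<union> (\<sigma> - \<tau>)" \<tau>p] assms(2) by auto
    then show "\<exists>f\<in>F. (\<forall>x\<in>\<tau>m. f x \<le> h x) \<and> (\<forall>x\<in>\<tau>p. f x \<ge> h x + t)" by blast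
  qed
qed

lemma shattered_antimono:
  assumes "shattered F t \<sigma>" "s \<le> t"
  shows "shattered F s \<sigma>"
proof -
  from assms(1) obtain h where h: "\<forall>\<sigma>m \<sigma>p. \<sigma>m \<union> \<sigma>p = \<sigma> \<and> \<sigma>m \<inter> \<sigma>p = {} \<longrightarrow>
      (\<exists>f\<in>F. (\<forall>x\<in>\<sigma>m. f x \<le> h x) \<and> (\<forall>x\<in>\<sigma>p. f x \<ge> h x + t))"
    unfolding shattered_def by blast
  show ?thesis
    unfolding shattered_def
  proof (intro exI[of _ h] allI impI)
    fix \<sigma>m \<sigma>p assume "\<sigma>m \<union> \<sigma>p = \<sigma> \<and> \<sigma>m \<inter> \<sigma>p = {}"
    then obtain f where f: "f \<in> F" "\<forall>x\<in>\<sigma>m. f x \<le> h x" "\<forall>x\<in>\<sigma>p. f x \<ge> h x + t" using h by blast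
    have "h x + s \<le> f x" if "x \<in> \<sigma>p" for x using f(3)[rule_format, OF that] assms(2) by linarith
    with f(1,2) show "\<exists>f\<in>F. (\<forall>x\<in>\<sigma>m. f x \<le> h x) \<and> (\<forall>x\<in>\<sigma>p. f x \<ge> h x + s)" by blast
  qed
qed

text \<open>An infinite shattered set contains finite shattered sets of every size, so
  \<open>\<infinity>\<close> is already the supremum of finite cardinalities.\<close>

lemma comb_dim_finite:
  "comb_dim \<Omega> F t = Sup {enat n | n. \<exists>\<sigma>\<subseteq>\<Omega>. finite \<sigma> \<and> card \<sigma> = n \<and> shattered F t \<sigma>}"
  (is "_ = Sup ?S")
proof (rule antisym)
  show "comb_dim \<Omega> F t \<le> Sup ?S"
    unfolding comb_dim_def
  proof (rule Sup_least, elim CollectE exE conjE)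
    fix x \<sigma> assume x: "x = ext_card \<sigma>" and \<sigma>: "\<sigma> \<subseteq> \<Omega>" "shattered F t \<sigma>"
    show "x \<le> Sup ?S"
    proof (cases "finite \<sigma>")
      case True
      then show ?thesis using x \<sigma> by (intro Sup_upper) (auto simp: ext_card_def)
    next
      case False
      have "enat n \<le> Sup ?S" for n
      proof -
        obtain \<tau> where "\<tau> \<subseteq> \<sigma>" "finite \<tau>" "card \<tau> = n"
          using infinite_arbitrarily_large[OF False] by blast
        then show ?thesis using \<sigma> shattered_subset[OF \<sigma>(2)] by (intro Sup_upper) blast
      qed
      then have "Sup ?S = \<infinity>" by (cases "Sup ?S") (auto dest: spec[of _ "Suc _"], metis Suc_n_not_le_n enat_ord_simps(1))
      then show ?thesis by simp
    qed
  qed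
  show "Sup ?S \<le> comb_dim \<Omega> F t"
    by (rule Sup_least) (auto intro: card_le_comb_dim)
qed

lemma comb_dim_antimono: "s \<le> t \<Longrightarrow> comb_dim \<Omega> F t \<le> comb_dim \<Omega> F s"
  unfolding comb_dim_def by (rule Sup_subset_mono) (auto intro: shattered_antimono)

lemma log_enat_mono: "m \<le> n \<Longrightarrow> log_enat m \<le> log_enat n"
proof (cases m; cases n)
  fix i j assume mn: "m \<le> n" "m = enat i" "n = enat j"
  show "log_enat m \<le> log_enat n"
  proof (cases "i = 0")
    case False
    then show ?thesis using mn by (auto simp: log_enat_def intro!: ennreal_leI)
  qed (use mn in \<open>simp add: log_enat_def\<close>)
qed (auto simp: log_enat_def)

lemma packing_number_antimono:
  assumes "0 \<le> s" "s \<le> t"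
  shows "packing_number \<Omega> F t \<le> packing_number \<Omega> F s"
proof -
  have st: "s\<^sup>2 \<le> t\<^sup>2" using assms(2,1) by (rule power_mono)
  show ?thesis
    unfolding packing_number_def[of _ _ t]
  proof (rule Sup_least, elim CollectE exE conjE)
    fix x n and \<mu> :: "'a pmf" and f :: "nat \<Rightarrow> 'a \<Rightarrow> real"
    assume f: "x = enat n" "finite (set_pmf \<mu>)" "set_pmf \<mu> \<subseteq> \<Omega>" "\<forall>i<n. f i \<in> F"
      and sep: "\<forall>i j. i < j \<and> j < n \<longrightarrow> t\<^sup>2 \<le> measure_pmf.expectation \<mu> (\<lambda>x. (f i x - f j x)\<^sup>2)"
    have "\<forall>i j. i < j \<and> j < n \<longrightarrow> s\<^sup>2 \<le> measure_pmf.expectation \<mu> (\<lambda>x. (f i x - f j x)\<^sup>2)"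
      using sep order_trans[OF st] by blast
    with f show "x \<le> packing_number \<Omega> F s"
      unfolding packing_number_def by (intro Sup_upper) blast
  qed
qed

text \<open>Symmetric difference with \<open>b\<close> moves this Hamming ball to the empty set. A
  set \<open>U\<close> of size below \<open>n / 4\<close> has weight
  \<open>2 powr (n / 4 - card U)\<close> at least \<open>1\<close>, and the weights of all subsets
  have a closed sum.\<close>

lemma card_near_subsets_le:
  assumes fin: "finite \<sigma>" and b: "b \<subseteq> \<sigma>"
  shows "real (card {T\<in>Pow \<sigma>. real (card (sym_diff T b)) < real (card \<sigma>) / 4})
    \<le> 2 powr (real (card \<sigma>) / 4) * (3 / 2) ^ card \<sigma>"
proof -
  let ?n = "card \<sigma>"
  let ?C = "{T\<in>Pow \<sigma>. real (card (sym_diff T b)) < real ?n / 4}"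
  let ?U = "{U\<in>Pow \<sigma>. real (card U) < real ?n / 4}"
  have "inj_on (\<lambda>T. sym_diff T b) ?C" by (auto simp: inj_on_def)
  then have "card ?C \<le> card ?U" using fin b by (intro card_inj_on_le[of "\<lambda>T. sym_diff T b"]) auto
  then have "real (card ?C) \<le> (\<Sum>U\<in>?U. 1)" by simp
  also have "\<dots> \<le> (\<Sum>U\<in>?U. 2 powr (real ?n / 4) * (1 / 2) ^ card U)"
  proof (intro sum_mono)
    fix U assume "U \<in> ?U"
    have "(1 / 2 :: real) ^ card U = 2 powr (- real (card U))"
      by (simp add: powr_minus powr_realpow power_one_over inverse_eq_divide)
    then have "2 powr (real ?n / 4) * (1 / 2) ^ card U = 2 powr (real ?n / 4 - real (card U))"
      by (simp only: powr_add[symmetric] add_uminus_conv_diff)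
    moreover have "1 \<le> 2 powr (real ?n / 4 - real (card U))"
      using \<open>U \<in> ?U\<close> by (intro ge_one_powr_ge_zero) auto
    ultimately show "1 \<le> 2 powr (real ?n / 4) * (1 / 2) ^ card U" by simp
  qed
  also have "\<dots> \<le> (\<Sum>U\<in>Pow \<sigma>. 2 powr (real ?n / 4) * (1 / 2) ^ card U)"
    using fin by (intro sum_mono2) auto
  also have "\<dots> = 2 powr (real ?n / 4) * (3 / 2) ^ ?n"
    using sum_power_card_Pow[OF fin, of "1 / 2"] by (simp flip: sum_distrib_left)
  finally show ?thesis .
qed

text \<open>The balls around a maximal separated family cover the cube, and
  \<open>card_near_subsets_le\<close> bounds their size.\<close>

lemma gilbert_varshamov:
  fixes \<sigma> :: "'a set"
  assumes fin: "finite \<sigma>"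
  shows "\<exists>B\<subseteq>Pow \<sigma>. real (card \<sigma>) \<le> 12 * ln (card B) \<and>
    (\<forall>S\<in>B. \<forall>T\<in>B. S \<noteq> T \<longrightarrow> real (card \<sigma>) / 4 \<le> real (card (sym_diff S T)))"
proof -
  let ?n = "card \<sigma>"
  \<comment> \<open>The conjunct \<open>S \<noteq> T\<close> keeps \<open>R\<close> irreflexive when
    \<open>\<sigma>\<close> is empty.\<close>
  define R :: "'a set \<Rightarrow> 'a set \<Rightarrow> bool" where "R = (\<lambda>S T. S \<noteq> T \<and> real ?n / 4 \<le> real (card (sym_diff S T)))"
  have "\<exists>B\<subseteq>Pow \<sigma>. (\<forall>S\<in>B. \<forall>T\<in>B. S \<noteq> T \<longrightarrow> R S T) \<and> (\<forall>S\<in>Pow \<sigma>. \<exists>T\<in>B. \<not> R S T)"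
    by (rule maximal_separated) (use fin in \<open>auto simp: R_def Un_commute\<close>)
  then obtain B where B: "B \<subseteq> Pow \<sigma>" "\<forall>S\<in>B. \<forall>T\<in>B. S \<noteq> T \<longrightarrow> R S T"
    "\<forall>S\<in>Pow \<sigma>. \<exists>T\<in>B. \<not> R S T" by blast
  show ?thesis
  proof (cases "?n = 0")
    case True
    then show ?thesis by (intro exI[of _ "{{}}"]) simp
  next
    case False
    then have n0: "0 < real ?n" by simp
    have "finite (Pow \<sigma>)" "Pow \<sigma> \<noteq> {}" using fin by auto
    then obtain b where b: "b \<in> B" "card (Pow \<sigma>) \<le> card B * card {T\<in>Pow \<sigma>. \<not> R T b}"
      using card_le_largest_cluster[OF _ _ B(1,3)] by blast
    have R: "\<not> R T b \<longleftrightarrow> real (card (sym_diff T b)) < real ?n / 4" for T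
      using n0 by (auto simp: R_def)
    have "2 ^ ?n = real (card (Pow \<sigma>))" using fin by (simp add: card_Pow)
    also have "\<dots> \<le> real (card B) * real (card {T\<in>Pow \<sigma>. \<not> R T b})"
      using of_nat_mono[OF b(2), where 'a=real] by simp
    also have "\<dots> \<le> real (card B) * (2 powr (real ?n / 4) * (3 / 2) ^ ?n)"
      unfolding R using card_near_subsets_le[OF fin, of b] b(1) B(1) by (intro mult_left_mono) auto
    finally have le: "2 ^ ?n \<le> real (card B) * (2 powr (real ?n / 4) * (3 / 2) ^ ?n)" .
    have cB: "0 < real (card B)"
      using b(1) B(1) fin by (auto simp: card_gt_0_iff intro: finite_subset)
    have "real ?n * ln 2 = ln (2 ^ ?n)" by (simp add: ln_realpow)
    also have "\<dots> \<le> ln (real (card B) * (2 powr (real ?n / 4) * (3 / 2) ^ ?n))"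
      using le cB by (subst ln_le_cancel_iff) auto
    also have "\<dots> = ln (card B) + (real ?n / 4 * ln 2 + real ?n * ln (3 / 2))"
      using cB by (simp add: ln_mult ln_realpow ln_powr)
    finally have 1: "real ?n / 4 * (3 * ln 2 - 4 * ln (3 / 2)) \<le> ln (card B)"
      by (simp add: algebra_simps)
    \<comment> \<open>The coefficient \<open>3 * ln 2 - 4 * ln (3 / 2)\<close> equals
      \<open>- ln (81 / 128)\<close>, which is at least \<open>47 / 128\<close>.\<close>
    have "ln (81 / 128 :: real) = 4 * ln 3 - 7 * ln 2"
      using ln_realpow[of 3 4] ln_realpow[of 2 7] by (simp add: ln_div)
    moreover have "ln (3 / 2 :: real) = ln 3 - ln 2" by (simp add: ln_div)
    ultimately have "1 / 3 \<le> 3 * ln 2 - 4 * ln (3 / 2 :: real)"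
      using ln_le_minus_one[of "81 / 128"] by simp
    from mult_left_mono[OF this, of "real ?n / 4"] 1
    have "real ?n \<le> 12 * ln (card B)" by simp
    then show ?thesis using B(1,2) by (intro exI[of _ B]) (simp add: R_def)
  qed
qed

lemma ln_le_KP_entropy:
  assumes "finite (set_pmf \<mu>)" "set_pmf \<mu> \<subseteq> \<Omega>" "\<And>i. i < n \<Longrightarrow> f i \<in> F"
    and "\<And>i j. i < j \<Longrightarrow> j < n \<Longrightarrow> t\<^sup>2 \<le> measure_pmf.expectation \<mu> (\<lambda>x. (f i x - f j x)\<^sup>2)"
  shows "ennreal (ln (real n)) \<le> KP_entropy \<Omega> F t"
proof -
  have "enat n \<le> packing_number \<Omega> F t"
    unfolding packing_number_def using assms by (intro Sup_upper) blast
  then show ?thesis unfolding KP_entropy_def using log_enat_mono by (fastforce simp: log_enat_def)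
qed

text \<open>The functions that realise two subsets differ by at least \<open>t\<close> on the
  symmetric difference. For two members of the Gilbert-Varshamov family this is at least a quarter
  of \<open>\<sigma>\<close>, so under the uniform measure their distance is at least
  \<open>t / 2\<close>.\<close>

lemma shattered_card_le_entropy:
  assumes t: "0 < t" and \<sigma>: "finite \<sigma>" "\<sigma> \<subseteq> \<Omega>" "shattered F t \<sigma>"
  shows "of_nat (card \<sigma>) \<le> 12 * KP_entropy \<Omega> F (t / 2)"
proof (cases "\<sigma> = {}")
  case False
  from \<sigma>(3) obtain h where h: "\<forall>\<sigma>m \<sigma>p. \<sigma>m \<union> \<sigma>p = \<sigma> \<and> \<sigma>m \<inter> \<sigma>p = {} \<longrightarrow>
      (\<exists>f\<in>F. (\<forall>x\<in>\<sigma>m. f x \<le> h x) \<and> (\<forall>x\<in>\<sigma>p. f x \<ge> h x + t))"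
    unfolding shattered_def by blast
  have "\<exists>f\<in>F. (\<forall>x\<in>\<sigma> - T. f x \<le> h x) \<and> (\<forall>x\<in>T. f x \<ge> h x + t)" if "T \<subseteq> \<sigma>" for T
    using h[rule_format, of "\<sigma> - T" T] that by auto
  then have "\<forall>T. \<exists>f. T \<subseteq> \<sigma> \<longrightarrow> f \<in> F \<and> (\<forall>x\<in>\<sigma> - T. f x \<le> h x) \<and> (\<forall>x\<in>T. f x \<ge> h x + t)" by blast
  then obtain \<phi> where "\<forall>T. T \<subseteq> \<sigma> \<longrightarrow> \<phi> T \<in> F \<and> (\<forall>x\<in>\<sigma> - T. \<phi> T x \<le> h x) \<and> (\<forall>x\<in>T. \<phi> T x \<ge> h x + t)"
    by (rule choice[THEN exE])
  then have \<phi>: "T \<subseteq> \<sigma> \<Longrightarrow> \<phi> T \<in> F" "T \<subseteq> \<sigma> \<Longrightarrow> x \<in> \<sigma> - T \<Longrightarrow> \<phi> T x \<le> h x"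
    "T \<subseteq> \<sigma> \<Longrightarrow> x \<in> T \<Longrightarrow> h x + t \<le> \<phi> T x" for T x by auto
  obtain B where B: "B \<subseteq> Pow \<sigma>" "real (card \<sigma>) \<le> 12 * ln (card B)"
    "\<forall>S\<in>B. \<forall>T\<in>B. S \<noteq> T \<longrightarrow> real (card \<sigma>) / 4 \<le> real (card (sym_diff S T))"
    using gilbert_varshamov[OF \<sigma>(1)] by blast
  have "finite B" using B(1) \<sigma>(1) by (auto intro: finite_subset)
  then obtain e where e: "bij_betw e {0..<card B} B" using ex_bij_betw_nat_finite by blast
  have eB: "e i \<in> B" if "i < card B" for i using e that by (auto simp: bij_betw_def)
  have n0: "0 < real (card \<sigma>)" using False \<sigma>(1) by (simp add: card_gt_0_iff)
  have "ennreal (ln (card B)) \<le> KP_entropy \<Omega> F (t / 2)"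
  proof (rule ln_le_KP_entropy[of "pmf_of_set \<sigma>" _ _ "\<lambda>i. \<phi> (e i)"])
    fix i j assume ij: "i < j" "j < card B"
    then have in_B: "e i \<in> B" "e j \<in> B" using eB by auto
    then have sub: "e i \<subseteq> \<sigma>" "e j \<subseteq> \<sigma>" using B(1) by auto
    have "e i \<noteq> e j" using e ij by (auto simp: bij_betw_def dest: inj_onD)
    then have "real (card \<sigma>) / 4 \<le> real (card (sym_diff (e i) (e j)))" using B(3) in_B by blast
    then have "(t / 2)\<^sup>2 * real (card \<sigma>) \<le> t\<^sup>2 * real (card (sym_diff (e i) (e j)))"
      using t by (simp add: power_divide)
    also have "\<dots> = (\<Sum>x\<in>sym_diff (e i) (e j). t\<^sup>2)" by simp
    also have "\<dots> \<le> (\<Sum>x\<in>sym_diff (e i) (e j). (\<phi> (e i) x - \<phi> (e j) x)\<^sup>2)"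
    proof (intro sum_mono)
      fix x assume x: "x \<in> sym_diff (e i) (e j)"
      have "t \<le> \<bar>\<phi> (e i) x - \<phi> (e j) x\<bar>"
      proof (cases "x \<in> e i")
        case True
        then show ?thesis using x sub \<phi>(2)[OF sub(2), of x] \<phi>(3)[OF sub(1), of x] by auto
      next
        case False
        then show ?thesis using x sub \<phi>(2)[OF sub(1), of x] \<phi>(3)[OF sub(2), of x] by auto
      qed
      then have "t\<^sup>2 \<le> \<bar>\<phi> (e i) x - \<phi> (e j) x\<bar>\<^sup>2" using t by (intro power_mono) auto
      then show "t\<^sup>2 \<le> (\<phi> (e i) x - \<phi> (e j) x)\<^sup>2" by simp
    qed
    also have "\<dots> \<le> (\<Sum>x\<in>\<sigma>. (\<phi> (e i) x - \<phi> (e j) x)\<^sup>2)"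
      using \<sigma>(1) sub by (intro sum_mono2) auto
    finally show "(t / 2)\<^sup>2 \<le> measure_pmf.expectation (pmf_of_set \<sigma>) (\<lambda>x. (\<phi> (e i) x - \<phi> (e j) x)\<^sup>2)"
      using False \<sigma>(1) n0 by (subst integral_pmf_of_set) (auto simp: pos_le_divide_eq)
  next
    show "\<phi> (e i) \<in> F" if "i < card B" for i using \<phi>(1) eB[OF that] B(1) by blast
  qed (use False \<sigma> in auto)
  have "of_nat (card \<sigma>) = ennreal (real (card \<sigma>))" by (simp add: ennreal_of_nat_eq_real_of_nat)
  also have "\<dots> \<le> ennreal (12 * ln (card B))" using B(2) by (rule ennreal_leI)
  also have "\<dots> = 12 * ennreal (ln (card B))" by (simp add: ennreal_mult')
  also have "\<dots> \<le> 12 * KP_entropy \<Omega> F (t / 2)"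
    using \<open>ennreal (ln (card B)) \<le> KP_entropy \<Omega> F (t / 2)\<close> by (rule mult_left_mono) simp
  finally show ?thesis .
qed simp

lemma dim_root_le_entropy:
  assumes "0 < t"
  shows "dim_root \<Omega> F t \<le> 4 * sqrt_ennreal (KP_entropy \<Omega> F (t / 2))"
  unfolding dim_root_def
proof (rule sqrt_ennreal_le)
  have "ennreal_of_enat (comb_dim \<Omega> F t) \<le> 12 * KP_entropy \<Omega> F (t / 2)"
    unfolding comb_dim_finite ennreal_of_enat_Sup
    using shattered_card_le_entropy[OF assms] by (intro SUP_least) auto
  \<comment> \<open>Here \<open>12\<close> is rounded up to the square \<open>16\<close>.\<close>
  also have "\<dots> \<le> (4 * sqrt_ennreal (KP_entropy \<Omega> F (t / 2)))\<^sup>2"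
    by (auto simp: power_mult_distrib intro!: mult_right_mono)
  finally show "ennreal_of_enat (comb_dim \<Omega> F t) \<le> (4 * sqrt_ennreal (KP_entropy \<Omega> F (t / 2)))\<^sup>2" .
qed

section \<open>Integration\<close>

lemma borel_measurable_antimono_ennreal:
  fixes f :: "real \<Rightarrow> ennreal"
  assumes "antimono f"
  shows "f \<in> borel_measurable borel"
proof (rule borel_measurableI_greater)
  fix y
  have "is_interval {x. y < f x}"
    unfolding is_interval_1 using assms by (auto dest: antimonoD intro: less_le_trans)
  then show "{x \<in> space borel. y < f x} \<in> sets borel"
    using real_interval_borel_measurable by simp
qed

lemma dim_root_measurable [measurable]: "dim_root \<Omega> F \<in> borel_measurable borel"
proof (rule borel_measurable_antimono_ennreal, rule antimonoI)
  fix s t :: real assume "s \<le> t"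
  then show "dim_root \<Omega> F t \<le> dim_root \<Omega> F s"
    unfolding dim_root_def by (intro sqrt_ennreal_mono) (simp add: comb_dim_antimono)
qed

text \<open>
  Truncation at \<open>0\<close> makes this antitone on all reals, since \<open>packing_number\<close> is even in \<open>t\<close>.
\<close>

definition entropy_root :: "'a set \<Rightarrow> ('a \<Rightarrow> real) set \<Rightarrow> real \<Rightarrow> ennreal" where
  "entropy_root \<Omega> F t = sqrt_ennreal (KP_entropy \<Omega> F (max 0 t))"

lemma entropy_root_measurable [measurable]: "entropy_root \<Omega> F \<in> borel_measurable borel"
proof (rule borel_measurable_antimono_ennreal, rule antimonoI)
  fix s t :: real assume "s \<le> t"
  then show "entropy_root \<Omega> F t \<le> entropy_root \<Omega> F s"
    unfolding entropy_root_def KP_entropy_def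
    by (intro sqrt_ennreal_mono log_enat_mono packing_number_antimono) auto
qed

lemma nn_integral_positive_scale:
  fixes f :: "real \<Rightarrow> ennreal"
  assumes [measurable]: "f \<in> borel_measurable borel" and c: "0 < c"
  shows "(\<integral>\<^sup>+t\<in>{0<..}. f (c * t) \<partial>lborel) = ennreal (1 / c) * (\<integral>\<^sup>+t\<in>{0<..}. f t \<partial>lborel)"
proof -
  have "(\<integral>\<^sup>+t\<in>{0<..}. f t \<partial>lborel) = ennreal \<bar>c\<bar> * (\<integral>\<^sup>+t. f (0 + c * t) * indicator {0<..} (0 + c * t) \<partial>lborel)"
    using c by (intro nn_integral_real_affine) auto
  also have "(\<integral>\<^sup>+t. f (0 + c * t) * indicator {0<..} (0 + c * t) \<partial>lborel) = (\<integral>\<^sup>+t\<in>{0<..}. f (c * t) \<partial>lborel)"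
    using c by (intro nn_integral_cong) (auto simp: indicator_def zero_less_mult_iff)
  finally have "ennreal (1 / c) * (\<integral>\<^sup>+t\<in>{0<..}. f t \<partial>lborel)
      = ennreal (1 / c) * ennreal c * (\<integral>\<^sup>+t\<in>{0<..}. f (c * t) \<partial>lborel)"
    using c by (simp add: mult.assoc)
  also have "ennreal (1 / c) * ennreal c = 1"
    using c by (simp flip: ennreal_mult)
  finally show ?thesis by simp
qed

lemma dim_integral_eq: "dim_integral \<Omega> F = (\<integral>\<^sup>+t\<in>{0<..}. dim_root \<Omega> F t \<partial>lborel)"
  by (simp add: dim_integral_def dim_root_def)

lemma entropy_integral_eq: "entropy_integral \<Omega> F = (\<integral>\<^sup>+t\<in>{0<..}. entropy_root \<Omega> F t \<partial>lborel)"
  unfolding entropy_integral_def entropy_root_def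
  by (intro nn_integral_cong) (auto simp: indicator_def max_def)

text \<open>The factor \<open>4\<close> is pointwise, and replacing \<open>t / 2\<close> by
  \<open>t\<close> in the integral contributes another \<open>2\<close>.\<close>

lemma dim_integral_le: "dim_integral \<Omega> F \<le> 8 * entropy_integral \<Omega> F"
proof -
  have "dim_integral \<Omega> F \<le> (\<integral>\<^sup>+t. 4 * (entropy_root \<Omega> F (1 / 2 * t) * indicator {0<..} t) \<partial>lborel)"
    unfolding dim_integral_eq
  proof (intro nn_integral_mono)
    fix t :: real
    show "dim_root \<Omega> F t * indicator {0<..} t \<le> 4 * (entropy_root \<Omega> F (1 / 2 * t) * indicator {0<..} t)"
      using dim_root_le_entropy[of t \<Omega> F] by (auto simp: indicator_def entropy_root_def max_def)
  qed
  also have "\<dots> = 4 * (\<integral>\<^sup>+t\<in>{0<..}. entropy_root \<Omega> F (1 / 2 * t) \<partial>lborel)"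
    by (intro nn_integral_cmult) measurable
  also have "\<dots> = 4 * (ennreal (1 / (1 / 2)) * entropy_integral \<Omega> F)"
    unfolding entropy_integral_eq by (subst nn_integral_positive_scale) auto
  also have "\<dots> = 8 * entropy_integral \<Omega> F"
    by (simp add: mult.assoc[symmetric])
  finally show ?thesis .
qed

text \<open>Integrating term by term, the substitution turns the scale
  \<open>2 ^ (i + k) / 32\<close> into the factor \<open>32 / 2 ^ (i + k)\<close>. The sums of
  \<open>2 ^ (-i)\<close> and \<open>(k + 1) * 2 ^ (-k)\<close> are \<open>2\<close> and
  \<open>4\<close>, and \<open>60 * 32 * 2 * 4 = 15360\<close>.\<close>

lemma entropy_integral_le: "entropy_integral \<Omega> F \<le> ennreal 15360 * dim_integral \<Omega> F"
proof -
  let ?I = "dim_integral \<Omega> F"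
  let ?c = "\<lambda>i k. 2 ^ k * (2 ^ i / 32) :: real"
  have "entropy_integral \<Omega> F \<le> (\<integral>\<^sup>+t. (\<Sum>i. \<Sum>k. ennreal (60 * real (Suc k)) *
      (dim_root \<Omega> F (?c i k * t) * indicator {0<..} t)) \<partial>lborel)"
    unfolding entropy_integral_def
  proof (intro nn_integral_mono)
    fix t :: real
    show "sqrt_ennreal (KP_entropy \<Omega> F t) * indicator {0<..} t \<le> (\<Sum>i. \<Sum>k. ennreal (60 * real (Suc k)) *
      (dim_root \<Omega> F (?c i k * t) * indicator {0<..} t))"
      using packing_entropy_le[of t \<Omega> F]
      by (auto simp: indicator_def local_bound_def mult_ac)
  qed
  also have "\<dots> = (\<Sum>i. \<Sum>k. \<integral>\<^sup>+t. ennreal (60 * real (Suc k)) *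
      (dim_root \<Omega> F (?c i k * t) * indicator {0<..} t) \<partial>lborel)"
  proof -
    have meas: "(\<lambda>t. ennreal (60 * real (Suc k)) * (dim_root \<Omega> F (?c i k * t) * indicator {0<..} t))
        \<in> borel_measurable lborel" for i k
      by measurable
    then have "(\<lambda>t. \<Sum>k. ennreal (60 * real (Suc k)) * (dim_root \<Omega> F (?c i k * t) * indicator {0<..} t))
        \<in> borel_measurable lborel" for i
      by (rule borel_measurable_suminf_order)
    then show ?thesis by (simp only: nn_integral_suminf meas)
  qed
  also have "\<dots> = (\<Sum>i. \<Sum>k. ennreal (1920 * (1 / 2) ^ i) * ennreal (real (Suc k) * (1 / 2) ^ k) * ?I)"
  proof (intro suminf_cong)
    fix i k
    have "(\<integral>\<^sup>+t. ennreal (60 * real (Suc k)) * (dim_root \<Omega> F (?c i k * t) * indicator {0<..} t) \<partial>lborel)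
        = ennreal (60 * real (Suc k)) * (\<integral>\<^sup>+t\<in>{0<..}. dim_root \<Omega> F (?c i k * t) \<partial>lborel)"
      by (intro nn_integral_cmult) measurable
    also have "\<dots> = ennreal (60 * real (Suc k)) * (ennreal (1 / ?c i k) * ?I)"
      unfolding dim_integral_eq by (subst nn_integral_positive_scale) auto
    also have "\<dots> = ennreal (60 * real (Suc k) * (1 / ?c i k)) * ?I"
      by (simp only: mult.assoc[symmetric]) (subst ennreal_mult, auto)
    also have "60 * real (Suc k) * (1 / ?c i k) = (1920 * (1 / 2) ^ i) * (real (Suc k) * (1 / 2) ^ k)"
      by (simp add: power_one_over field_simps)
    also have "ennreal \<dots> = ennreal (1920 * (1 / 2) ^ i) * ennreal (real (Suc k) * (1 / 2) ^ k)"
      by (intro ennreal_mult) auto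
    finally show "(\<integral>\<^sup>+t. ennreal (60 * real (Suc k)) * (dim_root \<Omega> F (?c i k * t) * indicator {0<..} t) \<partial>lborel)
        = ennreal (1920 * (1 / 2) ^ i) * ennreal (real (Suc k) * (1 / 2) ^ k) * ?I" .
  qed
  also have "\<dots> = (\<Sum>i. ennreal (1920 * (1 / 2) ^ i)) * (\<Sum>k. ennreal (real (Suc k) * (1 / 2) ^ k)) * ?I"
    by (simp only: mult.assoc ennreal_suminf_cmult ennreal_suminf_multc)
  also have "(\<Sum>i. ennreal (1920 * (1 / 2) ^ i)) = ennreal 3840"
  proof (rule suminf_ennreal_eq)
    show "(\<lambda>i. 1920 * (1 / 2) ^ i) sums (3840 :: real)"
      using sums_mult[OF geometric_sums[of "1 / 2 :: real"], of 1920] by simp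
  qed simp
  also have "(\<Sum>k. ennreal (real (Suc k) * (1 / 2) ^ k)) = ennreal 4"
  proof (rule suminf_ennreal_eq)
    show "(\<lambda>k. real (Suc k) * (1 / 2) ^ k) sums (4 :: real)"
      using geometric_deriv_sums[of "1 / 2 :: real"] by (simp add: power2_eq_square)
  qed simp
  also have "ennreal 3840 * ennreal 4 = ennreal 15360"
    by (subst ennreal_mult[symmetric]) auto
  finally show ?thesis .
qed

lemma two_sided_bound_15360: "two_sided_bound 15360 \<Omega> F"
  unfolding two_sided_bound_def
proof
  have "ennreal (1 / 15360) * dim_integral \<Omega> F \<le> ennreal (1 / 15360) * (8 * entropy_integral \<Omega> F)"
    by (intro mult_left_mono dim_integral_le) simp
  also have "\<dots> = ennreal (1 / 1920) * entropy_integral \<Omega> F"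
  proof -
    have "ennreal (1 / 15360) * 8 = ennreal (1 / 15360 * 8)"
      by (subst ennreal_mult) auto
    then show ?thesis by (simp add: mult.assoc[symmetric])
  qed
  also have "\<dots> \<le> ennreal 1 * entropy_integral \<Omega> F"
    by (intro mult_right_mono ennreal_leI) auto
  finally show "ennreal (1 / 15360) * dim_integral \<Omega> F \<le> entropy_integral \<Omega> F" by simp
qed (rule entropy_integral_le)

section \<open>Reduction to classes on the natural numbers\<close>

text \<open>Shattered sets are carried along \<open>g\<close>, with thresholds moved by its inverse.
  With \<open>g\<close> the identity this compares a domain with a subset of it; otherwise it
  relabels points.\<close>

lemma comb_dim_pullback:
  assumes inj: "inj_on g \<Omega>'" and g: "g ` \<Omega>' \<subseteq> \<Omega>"
    and F: "\<And>f'. f' \<in> F' \<Longrightarrow> \<exists>f\<in>F. \<forall>x\<in>\<Omega>'. f' x = f (g x)"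
  shows "comb_dim \<Omega>' F' t \<le> comb_dim \<Omega> F t"
  unfolding comb_dim_finite[of \<Omega>']
proof (rule Sup_least, elim CollectE exE conjE)
  fix x n \<sigma> assume x: "x = enat n" and \<sigma>: "\<sigma> \<subseteq> \<Omega>'" "finite \<sigma>" "card \<sigma> = n" "shattered F' t \<sigma>"
  from \<sigma>(4) obtain h where h: "\<forall>\<sigma>m \<sigma>p. \<sigma>m \<union> \<sigma>p = \<sigma> \<and> \<sigma>m \<inter> \<sigma>p = {} \<longrightarrow>
      (\<exists>f\<in>F'. (\<forall>x\<in>\<sigma>m. f x \<le> h x) \<and> (\<forall>x\<in>\<sigma>p. f x \<ge> h x + t))"
    unfolding shattered_def by blast
  have inj_\<sigma>: "inj_on g \<sigma>" using inj \<sigma>(1) by (rule inj_on_subset)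
  let ?i = "inv_into \<sigma> g"
  have "shattered F t (g ` \<sigma>)"
    unfolding shattered_def
  proof (intro exI[of _ "\<lambda>y. h (?i y)"] allI impI)
    fix \<tau>m \<tau>p assume part: "\<tau>m \<union> \<tau>p = g ` \<sigma> \<and> \<tau>m \<inter> \<tau>p = {}"
    let ?m = "{x\<in>\<sigma>. g x \<in> \<tau>m}" and ?p = "{x\<in>\<sigma>. g x \<in> \<tau>p}"
    have "?m \<union> ?p = \<sigma> \<and> ?m \<inter> ?p = {}" using part by blast
    from h[rule_format, OF this] obtain f' where f': "f' \<in> F'" "\<forall>x\<in>?m. f' x \<le> h x" "\<forall>x\<in>?p. f' x \<ge> h x + t" by blast
    from F[OF f'(1)] obtain f where f: "f \<in> F" "\<forall>x\<in>\<Omega>'. f' x = f (g x)" by blast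
    have inv_y: "?i y \<in> \<sigma>" "g (?i y) = y" if "y \<in> \<tau>m \<union> \<tau>p" for y
      using that part by (auto intro: inv_into_into f_inv_into_f)
    have val: "f y = f' (?i y)" if "y \<in> \<tau>m \<union> \<tau>p" for y
      using inv_y[OF that] f(2) \<sigma>(1) by (metis subsetD)
    show "\<exists>f\<in>F. (\<forall>x\<in>\<tau>m. f x \<le> h (?i x)) \<and> (\<forall>x\<in>\<tau>p. f x \<ge> h (?i x) + t)"
    proof (intro bexI[OF _ f(1)] conjI ballI)
      show "f y \<le> h (?i y)" if "y \<in> \<tau>m" for y
        using that f'(2) inv_y[of y] val[of y] by simp
      show "f y \<ge> h (?i y) + t" if "y \<in> \<tau>p" for y
        using that f'(3) inv_y[of y] val[of y] by simp
    qed
  qed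
  then show "x \<le> comb_dim \<Omega> F t"
    using card_le_comb_dim[of "g ` \<sigma>" \<Omega> F t] \<sigma> g x inj_\<sigma> by (auto simp: card_image)
qed

text \<open>The push-forward \<open>map_pmf g \<mu>\<close> preserves the integrals, since members
  of \<open>F'\<close> agree with compositions on the support of \<open>\<mu>\<close>.\<close>

lemma packing_number_pullback:
  fixes g :: "'b \<Rightarrow> 'a"
  assumes g: "g ` \<Omega>' \<subseteq> \<Omega>" and F: "\<And>f'. f' \<in> F' \<Longrightarrow> \<exists>f\<in>F. \<forall>x\<in>\<Omega>'. f' x = f (g x)"
  shows "packing_number \<Omega>' F' t \<le> packing_number \<Omega> F t"
  unfolding packing_number_def[of \<Omega>']
proof (rule Sup_least, elim CollectE exE conjE)
  fix x n and \<mu> :: "'b pmf" and f' :: "nat \<Rightarrow> 'b \<Rightarrow> real"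
  assume x: "x = enat n" and \<mu>: "finite (set_pmf \<mu>)" "set_pmf \<mu> \<subseteq> \<Omega>'" and f': "\<forall>i<n. f' i \<in> F'"
    and sep: "\<forall>i j. i < j \<and> j < n \<longrightarrow> t\<^sup>2 \<le> measure_pmf.expectation \<mu> (\<lambda>x. (f' i x - f' j x)\<^sup>2)"
  have "\<forall>i. \<exists>f. i < n \<longrightarrow> f \<in> F \<and> (\<forall>x\<in>\<Omega>'. f' i x = f (g x))" using f' F by blast
  then obtain f where f: "\<forall>i. i < n \<longrightarrow> f i \<in> F \<and> (\<forall>x\<in>\<Omega>'. f' i x = f i (g x))"
    by (rule choice[THEN exE])
  have E: "measure_pmf.expectation (map_pmf g \<mu>) (\<lambda>x. (f i x - f j x)\<^sup>2)
      = measure_pmf.expectation \<mu> (\<lambda>x. (f' i x - f' j x)\<^sup>2)" if "i < n" "j < n" for i j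
    unfolding integral_map_pmf
    using f that \<mu>(2) by (intro integral_cong_AE) (auto simp: AE_measure_pmf_iff)
  show "x \<le> packing_number \<Omega> F t"
    unfolding packing_number_def
  proof (rule Sup_upper, intro CollectI exI[of _ n] exI[of _ "map_pmf g \<mu>"] exI[of _ f] conjI x allI impI)
    fix i j assume "i < j \<and> j < n"
    then show "t\<^sup>2 \<le> measure_pmf.expectation (map_pmf g \<mu>) (\<lambda>x. (f i x - f j x)\<^sup>2)"
      using sep E[of i j] by auto
  next
    show "set_pmf (map_pmf g \<mu>) \<subseteq> \<Omega>" using \<mu>(2) g unfolding set_map_pmf by blast
  qed (use \<mu> f g in auto)
qed

section \<open>Countable families of witnesses\<close>

text \<open>A greatest element suffices if there is one. Otherwise above each \<open>t\<close> in
  \<open>S\<close> there is a larger element of \<open>S\<close>; a rational lies between them, and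
  one element of \<open>S\<close> is chosen above each such rational.\<close>

lemma countable_cofinal_subset:
  fixes S :: "real set"
  obtains T where "countable T" "T \<subseteq> S" "\<And>t. t \<in> S \<Longrightarrow> \<exists>q\<in>T. t \<le> q"
proof (cases "\<exists>m\<in>S. \<forall>t\<in>S. t \<le> m")
  case True
  then obtain m where "m \<in> S" "\<forall>t\<in>S. t \<le> m" by blast
  then show ?thesis using that[of "{m}"] by auto
next
  case False
  define Q where "Q = {r\<in>\<rat>. \<exists>s\<in>S. r < s}"
  have "\<forall>r. \<exists>s. r \<in> Q \<longrightarrow> s \<in> S \<and> r < s" by (auto simp: Q_def)
  then obtain \<phi> where \<phi>: "\<forall>r. r \<in> Q \<longrightarrow> \<phi> r \<in> S \<and> r < \<phi> r" by (rule choice[THEN exE])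
  show ?thesis
  proof (rule that[of "\<phi> ` Q"])
    show "countable (\<phi> ` Q)" unfolding Q_def
      by (intro countable_image countable_subset[OF _ countable_rat]) auto
    show "\<phi> ` Q \<subseteq> S" using \<phi> by auto
    fix t assume "t \<in> S"
    with False obtain s where s: "s \<in> S" "t < s" by (meson not_le)
    obtain r where r: "r \<in> \<rat>" "t < r" "r < s" using Rats_dense_in_real[OF s(2)] by blast
    then have "r \<in> Q" using s(1) by (auto simp: Q_def)
    then show "\<exists>q\<in>\<phi> ` Q. t \<le> q" using \<phi> r(2) by (intro bexI[of _ "\<phi> r"]) auto
  qed
qed

text \<open>One witness is chosen for each scale of a countable cofinal set. A witness at a larger
  scale \<open>s\<close> is enough whenever the property is antitone in the scale, as for shattering
  and packing.\<close>

lemma countable_witnesses: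
  fixes P :: "nat \<Rightarrow> real \<Rightarrow> 'w \<Rightarrow> bool"
  obtains W where "countable W"
    "\<forall>n t w. P n t w \<longrightarrow> (\<exists>s\<ge>t. \<exists>w'\<in>W. P n s w')"
proof -
  have "\<forall>n. \<exists>T. countable T \<and> T \<subseteq> {t. \<exists>w. P n t w} \<and> (\<forall>t\<in>{t. \<exists>w. P n t w}. \<exists>q\<in>T. t \<le> q)"
  proof
    fix n
    show "\<exists>T. countable T \<and> T \<subseteq> {t. \<exists>w. P n t w} \<and> (\<forall>t\<in>{t. \<exists>w. P n t w}. \<exists>q\<in>T. t \<le> q)"
      by (rule countable_cofinal_subset[of "{t. \<exists>w. P n t w}"]) blast
  qed
  then obtain T where T: "\<forall>n. countable (T n) \<and> T n \<subseteq> {t. \<exists>w. P n t w} \<and> (\<forall>t\<in>{t. \<exists>w. P n t w}. \<exists>q\<in>T n. t \<le> q)"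
    by (rule choice[THEN exE])
  define W where "W = (\<Union>n. (\<lambda>t. SOME w. P n t w) ` T n)"
  show ?thesis
  proof (rule that[of W])
    show "countable W" unfolding W_def using T by (intro countable_UN countable_image) auto
    show "\<forall>n t w. P n t w \<longrightarrow> (\<exists>s\<ge>t. \<exists>w'\<in>W. P n s w')"
    proof (intro allI impI)
      fix n t w assume "P n t w"
      then obtain s where s: "s \<in> T n" "t \<le> s" using T by blast
      have "\<exists>w. P n s w" using T s(1) by blast
      then have "P n s (SOME w. P n s w)" by (rule someI_ex)
      moreover have "(SOME w. P n s w) \<in> W" unfolding W_def using s(1) by blast
      ultimately show "\<exists>s\<ge>t. \<exists>w'\<in>W. P n s w'" using s(2) by blast
    qed
  qed
qed

lemma countable_domain_dim:
  obtains \<Omega>0 where "countable \<Omega>0" "\<Omega>0 \<subseteq> \<Omega>" "\<forall>t. comb_dim \<Omega> F t \<le> comb_dim \<Omega>0 F t"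
proof -
  define P where "P = (\<lambda>n t \<sigma>. \<sigma> \<subseteq> \<Omega> \<and> finite \<sigma> \<and> card \<sigma> = n \<and> shattered F t \<sigma>)"
  obtain W where W: "countable W" "\<forall>n t \<sigma>. P n t \<sigma> \<longrightarrow> (\<exists>s\<ge>t. \<exists>\<tau>\<in>W. P n s \<tau>)"
    by (rule countable_witnesses[of P])
  define \<Omega>0 where "\<Omega>0 = (\<Union>\<sigma>\<in>{\<sigma>\<in>W. \<sigma> \<subseteq> \<Omega> \<and> finite \<sigma>}. \<sigma>)"
  show ?thesis
  proof (rule that[of \<Omega>0])
    show "countable \<Omega>0" unfolding \<Omega>0_def
      using W(1) by (intro countable_UN) (auto intro: countable_finite countable_subset)
    show "\<Omega>0 \<subseteq> \<Omega>" unfolding \<Omega>0_def by blast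
    have "comb_dim \<Omega> F t \<le> comb_dim \<Omega>0 F t" for t
      unfolding comb_dim_finite[of \<Omega>]
    proof (rule Sup_least, elim CollectE exE conjE)
      fix x n \<sigma> assume x: "x = enat n" and "\<sigma> \<subseteq> \<Omega>" "finite \<sigma>" "card \<sigma> = n" "shattered F t \<sigma>"
      then have "P n t \<sigma>" by (simp add: P_def)
      then obtain s \<tau> where s: "t \<le> s" "\<tau> \<in> W" "P n s \<tau>" using W(2) by blast
      then have "\<tau> \<subseteq> \<Omega>0" "finite \<tau>" "card \<tau> = n" "shattered F t \<tau>"
        using shattered_antimono[of F s \<tau> t] by (auto simp: P_def \<Omega>0_def)
      then show "x \<le> comb_dim \<Omega>0 F t" using card_le_comb_dim[of \<tau> \<Omega>0 F t] x by simp
    qed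
    then show "\<forall>t. comb_dim \<Omega> F t \<le> comb_dim \<Omega>0 F t" by blast
  qed
qed

lemma countable_domain_packing:
  obtains \<Omega>0 where "countable \<Omega>0" "\<Omega>0 \<subseteq> \<Omega>" "\<forall>t>0. packing_number \<Omega> F t \<le> packing_number \<Omega>0 F t"
proof -
  define P where "P = (\<lambda>n t (\<mu> :: 'a pmf). 0 < t \<and> finite (set_pmf \<mu>) \<and> set_pmf \<mu> \<subseteq> \<Omega> \<and>
    (\<exists>f :: nat \<Rightarrow> 'a \<Rightarrow> real. (\<forall>i<n. f i \<in> F) \<and>
      (\<forall>i j. i < j \<and> j < n \<longrightarrow> measure_pmf.expectation \<mu> (\<lambda>x. (f i x - f j x)\<^sup>2) \<ge> t\<^sup>2)))"
  obtain W where W: "countable W" "\<forall>n t \<mu>. P n t \<mu> \<longrightarrow> (\<exists>s\<ge>t. \<exists>\<nu>\<in>W. P n s \<nu>)"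
    by (rule countable_witnesses[of P])
  define \<Omega>0 where "\<Omega>0 = (\<Union>\<mu>\<in>{\<mu>\<in>W. set_pmf \<mu> \<subseteq> \<Omega>}. set_pmf \<mu>)"
  show ?thesis
  proof (rule that[of \<Omega>0])
    show "countable \<Omega>0" unfolding \<Omega>0_def
      using W(1) by (intro countable_UN countable_set_pmf) (auto intro: countable_subset)
    show "\<Omega>0 \<subseteq> \<Omega>" unfolding \<Omega>0_def by blast
    have "packing_number \<Omega> F t \<le> packing_number \<Omega>0 F t" if t: "0 < t" for t
      unfolding packing_number_def[of \<Omega>]
    proof (rule Sup_least, elim CollectE exE conjE)
      fix x n and \<mu> :: "'a pmf" and f :: "nat \<Rightarrow> 'a \<Rightarrow> real"
      assume x: "x = enat n" and "finite (set_pmf \<mu>)" "set_pmf \<mu> \<subseteq> \<Omega>" "\<forall>i<n. f i \<in> F"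
        "\<forall>i j. i < j \<and> j < n \<longrightarrow> t\<^sup>2 \<le> measure_pmf.expectation \<mu> (\<lambda>x. (f i x - f j x)\<^sup>2)"
      then have "P n t \<mu>" using t unfolding P_def by blast
      then obtain s \<nu> where s: "t \<le> s" "\<nu> \<in> W" "P n s \<nu>" using W(2) by blast
      then have \<nu>: "finite (set_pmf \<nu>)" "set_pmf \<nu> \<subseteq> \<Omega>0" by (auto simp: P_def \<Omega>0_def)
      from s(3) obtain f where "\<forall>i<n. f i \<in> F"
        "\<forall>i j. i < j \<and> j < n \<longrightarrow> s\<^sup>2 \<le> measure_pmf.expectation \<nu> (\<lambda>x. (f i x - f j x)\<^sup>2)"
        unfolding P_def by blast
      then have "enat n \<le> packing_number \<Omega>0 F s"
        unfolding packing_number_def using \<nu> by (intro Sup_upper) blast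
      also have "\<dots> \<le> packing_number \<Omega>0 F t" using t s(1) by (intro packing_number_antimono) auto
      finally show "x \<le> packing_number \<Omega>0 F t" by (simp add: x)
    qed
    then show "\<forall>t>0. packing_number \<Omega> F t \<le> packing_number \<Omega>0 F t" by blast
  qed
qed

text \<open>A countable domain carrying all witnesses has the same dimensions and packing numbers as
  \<open>\<Omega>\<close>. Enumerating it and composing \<open>F\<close> with the inverse
  enumeration moves the class to \<open>nat\<close>; the pullback lemmas, used in both directions,
  give equality.\<close>

lemma countable_class_on_nat:
  fixes \<Omega> :: "'a set"
  obtains \<Omega>' :: "nat set" and F' where
    "dim_integral \<Omega>' F' = dim_integral \<Omega> F" "entropy_integral \<Omega>' F' = entropy_integral \<Omega> F"
proof -
  obtain \<Omega>1 where 1: "countable \<Omega>1" "\<Omega>1 \<subseteq> \<Omega>" "\<forall>t. comb_dim \<Omega> F t \<le> comb_dim \<Omega>1 F t"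
    by (rule countable_domain_dim[of \<Omega> F])
  obtain \<Omega>2 where 2: "countable \<Omega>2" "\<Omega>2 \<subseteq> \<Omega>" "\<forall>t>0. packing_number \<Omega> F t \<le> packing_number \<Omega>2 F t"
    by (rule countable_domain_packing[of \<Omega> F])
  define \<Omega>0 where "\<Omega>0 = \<Omega>1 \<union> \<Omega>2"
  have c: "countable \<Omega>0" using 1 2 by (simp add: \<Omega>0_def)
  let ?e = "to_nat_on \<Omega>0" and ?d = "from_nat_into \<Omega>0"
  let ?\<Omega> = "?e ` \<Omega>0" and ?F = "(\<lambda>f. f \<circ> ?d) ` F"
  have de: "?d (?e x) = x" if "x \<in> \<Omega>0" for x using c that by simp
  have inj_d: "inj_on ?d ?\<Omega>" using de by (auto simp: inj_on_def)
  have inj_e: "inj_on ?e \<Omega>0" using c by (rule inj_on_to_nat_on)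
  have d\<Omega>: "?d ` ?\<Omega> \<subseteq> \<Omega>" using de 1(2) 2(2) by (auto simp: \<Omega>0_def)
  have Fd: "\<exists>f\<in>F. \<forall>x\<in>?\<Omega>. f' x = f (?d x)" if "f' \<in> ?F" for f' using that by auto
  have Fe: "\<exists>f'\<in>?F. \<forall>x\<in>\<Omega>0. f x = f' (?e x)" if "f \<in> F" for f using that de by auto
  have dim: "comb_dim ?\<Omega> ?F t = comb_dim \<Omega> F t" for t
  proof (rule antisym)
    show "comb_dim ?\<Omega> ?F t \<le> comb_dim \<Omega> F t" by (rule comb_dim_pullback[OF inj_d d\<Omega> Fd])
    have "comb_dim \<Omega> F t \<le> comb_dim \<Omega>1 F t" using 1(3) by blast
    also have "\<dots> \<le> comb_dim \<Omega>0 F t" by (rule comb_dim_pullback[of "\<lambda>x. x"]) (auto simp: \<Omega>0_def)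
    also have "\<dots> \<le> comb_dim ?\<Omega> ?F t" by (rule comb_dim_pullback[OF inj_e order_refl Fe])
    finally show "comb_dim \<Omega> F t \<le> comb_dim ?\<Omega> ?F t" .
  qed
  have pack: "packing_number ?\<Omega> ?F t = packing_number \<Omega> F t" if "0 < t" for t
  proof (rule antisym)
    show "packing_number ?\<Omega> ?F t \<le> packing_number \<Omega> F t" by (rule packing_number_pullback[OF d\<Omega> Fd])
    have "packing_number \<Omega> F t \<le> packing_number \<Omega>2 F t" using that 2(3) by blast
    also have "\<dots> \<le> packing_number \<Omega>0 F t" by (rule packing_number_pullback[of "\<lambda>x. x"]) (auto simp: \<Omega>0_def)
    also have "\<dots> \<le> packing_number ?\<Omega> ?F t" by (rule packing_number_pullback[OF order_refl Fe])
    finally show "packing_number \<Omega> F t \<le> packing_number ?\<Omega> ?F t" .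
  qed
  show ?thesis
  proof (rule that[of ?\<Omega> ?F])
    show "dim_integral ?\<Omega> ?F = dim_integral \<Omega> F" by (simp only: dim_integral_def dim)
    show "entropy_integral ?\<Omega> ?F = entropy_integral \<Omega> F"
      unfolding entropy_integral_def KP_entropy_def
      by (intro nn_integral_cong) (auto simp: indicator_def pack)
  qed
qed

theorem theorem1p2:
  shows "absolute_const \<ge> 1 \<and>
    (\<forall>(\<Omega> :: 'a set) (F :: ('a \<Rightarrow> real) set).
       ennreal (1 / absolute_const) * dim_integral \<Omega> F \<le> entropy_integral \<Omega> F \<and>
       entropy_integral \<Omega> F \<le> ennreal absolute_const * dim_integral \<Omega> F)"
proof -
  \<comment> \<open>The value \<open>15360\<close> only shows that the choice is possible. Of the
    chosen constant nothing but its property for classes on \<open>nat\<close> is known, so classes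
    on other types are moved there.\<close>
  have "\<exists>C. C \<ge> 1 \<and> (\<forall>(\<Omega> :: nat set) F. two_sided_bound C \<Omega> F)"
    using two_sided_bound_15360 by (intro exI[of _ 15360]) auto
  then have C: "absolute_const \<ge> 1 \<and> (\<forall>(\<Omega> :: nat set) F. two_sided_bound absolute_const \<Omega> F)"
    unfolding absolute_const_def by (rule someI_ex)
  have "two_sided_bound absolute_const \<Omega> F" for \<Omega> :: "'a set" and F
  proof -
    obtain \<Omega>' :: "nat set" and F' where
      "dim_integral \<Omega>' F' = dim_integral \<Omega> F" "entropy_integral \<Omega>' F' = entropy_integral \<Omega> F"
      by (rule countable_class_on_nat)
    moreover have "two_sided_bound absolute_const \<Omega>' F'" using C by blast
    ultimately show ?thesis by (simp add: two_sided_bound_def)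
  qed
  with C show ?thesis by (simp add: two_sided_bound_def)
qed

end
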